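(* Let $(M,\varphi,\xi,\eta,g,\varepsilon,a,b,c)$ be an Einstein-like $(\varepsilon)$-almost paracontact metric manifold admitting an $\eta$-Ricci soliton $(g,\xi,\lambda,\mu)$ whose potential vector field $\xi$ is torse-forming. Then $M$ is an $\eta$-Einstein manifold.
   Context: An $(\varepsilon)$-almost paracontact metric structure $(\varphi,\xi,\eta,g,\varepsilon)$ on an $n$-dimensional manifold $M$ consists of a $(1,1)$-tensor field $\varphi$, a vector field $\xi$, a $1$-form $\eta$, a pseudo-Riemannian metric $g$ and $\varepsilon\in\{1,-1\}$ with $\varphi^2=I-\eta\otimes\xi$, $\eta(\xi)=1$, $\varphi\xi=0$, $\eta\circ\varphi=0$ and $g(\varphi X,\varphi Y)=g(X,Y)-\varepsilon\eta(X)\eta(Y)$ for all vector fields $X,Y$. (Consequently $g(X,\xi)=\varepsilon\eta(X)$ and $g(\varphi X,Y)=g(X,\varphi Y)$.) $\nabla$ is the Levi-Civita connection of $g$ and $S$ the Ricci tensor, with conventions $R(X,Y)Z=\nabla_X\nabla_YZ-\nabla_Y\nabla_XZ-\nabla_{[X,Y]}Z$, $S(Y,Z)=\mathrm{trace}(X\mapsto R(X,Y)Z)$. $(M,\varphi,\xi,\eta,g,\varepsilon,a,b,c)$ is Einstein-like if $a,b,c$ are real constants with $S(X,Y)=a\,g(X,Y)+b\,g(\varphi X,Y)+c\,\eta(X)\eta(Y)$ for all vector fields $X,Y$. $M$ is $\eta$-Einstein if it satisfies such an equation with $b=0$, i.e. there are real constants $a',c'$ with $S=a'g+c'\eta\otimes\eta$.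 $(g,\xi,\lambda,\mu)$, with $\lambda,\mu$ real constants, is an $\eta$-Ricci soliton if $\frac12\mathcal{L}_\xi g+S+\lambda g+\mu\,\eta\otimes\eta=0$. $\xi$ is torse-forming if $\nabla_X\xi=fX+w(X)\xi$ for all vector fields $X$, for some smooth function $f$ and some $1$-form $w$. *)

theory Defs
  imports "HOL-Analysis.Analysis" "HOL-Library.Function_Algebras"
begin

instantiation "fun" :: (type, scaleR) scaleR
begin
definition scaleR_fun_def: "scaleR c f = (\<lambda>x. scaleR c (f x))"
instance ..
end

lemma scaleR_fun_apply [simp]: "(c *\<^sub>R f) x = c *\<^sub>R f x"
  by (simp add: scaleR_fun_def)

instance "fun" :: (type, real_vector) real_vector
  by standard (simp_all add: fun_eq_iff scaleR_add_right scaleR_add_left)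

text \<open>Additivity and homogeneity on a subspace \<^term>\<open>V\<close>; values outside \<^term>\<open>V\<close> are irrelevant.\<close>

definition linear_on_subspace :: "'v::real_vector set \<Rightarrow> ('v \<Rightarrow> 'w::real_vector) \<Rightarrow> bool" where
  "linear_on_subspace V T \<longleftrightarrow>
     (\<forall>u\<in>V. \<forall>v\<in>V. T (u + v) = T u + T v) \<and> (\<forall>c. \<forall>u\<in>V. T (c *\<^sub>R u) = c *\<^sub>R T u)"

text \<open>Trace of an endomorphism of a finite-dimensional subspace \<^term>\<open>V\<close>: the sum of the diagonal
  entries of its matrix in a basis.  The value does not depend on the basis that is picked.\<close>

definition trace_on :: "'v::real_vector set \<Rightarrow> ('v \<Rightarrow> 'v) \<Rightarrow> real" where
  "trace_on V T =
     (let B = (SOME B. independent B \<and> B \<subseteq> V \<and> span B = V)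
      in \<Sum>b\<in>B. representation B (T b) b)"

text \<open>\<open>C\<^sup>k\<close> maps on an open set: all partial derivatives exist (in the Frechet sense) and are
  \<open>C\<^bsup>k-1\<^esup>\<close>.\<close>

primrec Ck_on :: "nat \<Rightarrow> 'e::euclidean_space set \<Rightarrow> ('e \<Rightarrow> 'f::real_normed_vector) \<Rightarrow> bool" where
  "Ck_on 0 S f \<longleftrightarrow> continuous_on S f"
| "Ck_on (Suc k) S f \<longleftrightarrow>
     (\<forall>x\<in>S. f differentiable (at x)) \<and>
     (\<forall>i\<in>Basis. Ck_on k S (\<lambda>x. frechet_derivative f (at x) i))"

definition smooth_on :: "'e::euclidean_space set \<Rightarrow> ('e \<Rightarrow> 'f::real_normed_vector) \<Rightarrow> bool" where
  "smooth_on S f \<longleftrightarrow> (\<forall>k. Ck_on k S f)"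

text \<open>The manifold is the whole type \<open>'m\<close>, a Hausdorff second countable space; the model space
  \<open>'e\<close> plays the role of \<open>\<real>\<^sup>n\<close>.  A chart is a pair of its domain and its coordinate map, and an atlas
  (not necessarily maximal) determines the smooth structure.\<close>

type_synonym ('m, 'e) chart = "'m set \<times> ('m \<Rightarrow> 'e)"

definition smooth_atlas ::
  "('m::{t2_space,second_countable_topology}, 'e::euclidean_space) chart set \<Rightarrow> bool" where
  "smooth_atlas A \<longleftrightarrow>
     (\<Union>(U, x)\<in>A. U) = UNIV \<and>
     (\<forall>(U, x)\<in>A. open U \<and> open (x ` U) \<and> homeomorphism U (x ` U) x (inv_into U x)) \<and>
     (\<forall>(U, x)\<in>A. \<forall>(V, y)\<in>A. smooth_on (x ` (U \<inter> V)) (y \<circ> inv_into U x))"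

definition smooth_functions :: "('m, 'e::euclidean_space) chart set \<Rightarrow> ('m \<Rightarrow> real) set" where
  "smooth_functions A = {f. \<forall>(U, x)\<in>A. smooth_on (x ` U) (f \<circ> inv_into U x)}"

text \<open>A tangent vector at \<open>p\<close> is a derivation at \<open>p\<close> of the algebra of smooth functions.  It is
  extended by 0 to the non-smooth functions, so that equality of tangent vectors is equality in HOL.\<close>

type_synonym 'm tangent = "('m \<Rightarrow> real) \<Rightarrow> real"
type_synonym 'm vfield = "'m \<Rightarrow> 'm tangent"

definition tangent_space :: "('m, 'e::euclidean_space) chart set \<Rightarrow> 'm \<Rightarrow> 'm tangent set" where
  "tangent_space A p =
     {v. linear_on_subspace (smooth_functions A) v \<and>
         (\<forall>f\<in>smooth_functions A. \<forall>h\<in>smooth_functions A.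
            v (\<lambda>q. f q * h q) = v f * h p + f p * v h) \<and>
         (\<forall>f. f \<notin> smooth_functions A \<longrightarrow> v f = 0)}"

definition vector_fields :: "('m, 'e::euclidean_space) chart set \<Rightarrow> 'm vfield set" where
  "vector_fields A =
     {X. (\<forall>p. X p \<in> tangent_space A p) \<and>
         (\<forall>f\<in>smooth_functions A. (\<lambda>p. X p f) \<in> smooth_functions A)}"

definition fmult :: "('m \<Rightarrow> real) \<Rightarrow> 'm vfield \<Rightarrow> 'm vfield" where
  "fmult f X = (\<lambda>p. f p *\<^sub>R X p)"

definition lie_bracket ::
  "('m, 'e::euclidean_space) chart set \<Rightarrow> 'm vfield \<Rightarrow> 'm vfield \<Rightarrow> 'm vfield" where
  "lie_bracket A X Y =
     (\<lambda>p f. if f \<in> smooth_functions A then X p (\<lambda>q. Y q f) - Y p (\<lambda>q. X q f) else 0)"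

text \<open>Tensor fields are families of (multi)linear maps on the tangent spaces that send smooth
  vector fields to smooth objects.\<close>

definition one_form ::
  "('m, 'e::euclidean_space) chart set \<Rightarrow> ('m \<Rightarrow> 'm tangent \<Rightarrow> real) \<Rightarrow> bool" where
  "one_form A \<omega> \<longleftrightarrow>
     (\<forall>p. linear_on_subspace (tangent_space A p) (\<omega> p)) \<and>
     (\<forall>X\<in>vector_fields A. (\<lambda>p. \<omega> p (X p)) \<in> smooth_functions A)"

definition tensor_field_11 ::
  "('m, 'e::euclidean_space) chart set \<Rightarrow> ('m \<Rightarrow> 'm tangent \<Rightarrow> 'm tangent) \<Rightarrow> bool" where
  "tensor_field_11 A T \<longleftrightarrow>
     (\<forall>p. linear_on_subspace (tangent_space A p) (T p) \<and>
          T p ` tangent_space A p \<subseteq> tangent_space A p) \<and>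
     (\<forall>X\<in>vector_fields A. (\<lambda>p. T p (X p)) \<in> vector_fields A)"

definition pseudo_riemannian_metric ::
  "('m, 'e::euclidean_space) chart set \<Rightarrow> ('m \<Rightarrow> 'm tangent \<Rightarrow> 'm tangent \<Rightarrow> real) \<Rightarrow> bool" where
  "pseudo_riemannian_metric A g \<longleftrightarrow>
     (\<forall>p. (\<forall>u\<in>tangent_space A p. linear_on_subspace (tangent_space A p) (g p u)) \<and>
          (\<forall>u\<in>tangent_space A p. \<forall>v\<in>tangent_space A p. g p u v = g p v u) \<and>
          (\<forall>u\<in>tangent_space A p. (\<forall>v\<in>tangent_space A p. g p u v = 0) \<longrightarrow> u = 0)) \<and>
     (\<forall>X\<in>vector_fields A. \<forall>Y\<in>vector_fields A. (\<lambda>p. g p (X p) (Y p)) \<in> smooth_functions A)"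

definition affine_connection ::
  "('m, 'e::euclidean_space) chart set \<Rightarrow> ('m vfield \<Rightarrow> 'm vfield \<Rightarrow> 'm vfield) \<Rightarrow> bool" where
  "affine_connection A D \<longleftrightarrow>
     (\<forall>X\<in>vector_fields A. \<forall>Y\<in>vector_fields A. D X Y \<in> vector_fields A) \<and>
     (\<forall>X\<in>vector_fields A. \<forall>Y\<in>vector_fields A. \<forall>Z\<in>vector_fields A.
        D (X + Y) Z = D X Z + D Y Z \<and> D X (Y + Z) = D X Y + D X Z) \<and>
     (\<forall>f\<in>smooth_functions A. \<forall>X\<in>vector_fields A. \<forall>Y\<in>vector_fields A.
        D (fmult f X) Y = fmult f (D X Y) \<and>
        D X (fmult f Y) = fmult f (D X Y) + fmult (\<lambda>p. X p f) Y)"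

text \<open>The operator \<^term>\<open>D\<close> is only constrained on vector fields, where torsion-freeness and
  metric compatibility determine it uniquely.\<close>

definition levi_civita_connection ::
  "('m, 'e::euclidean_space) chart set \<Rightarrow> ('m \<Rightarrow> 'm tangent \<Rightarrow> 'm tangent \<Rightarrow> real) \<Rightarrow>
   ('m vfield \<Rightarrow> 'm vfield \<Rightarrow> 'm vfield) \<Rightarrow> bool" where
  "levi_civita_connection A g D \<longleftrightarrow>
     affine_connection A D \<and>
     (\<forall>X\<in>vector_fields A. \<forall>Y\<in>vector_fields A. D X Y - D Y X = lie_bracket A X Y) \<and>
     (\<forall>X\<in>vector_fields A. \<forall>Y\<in>vector_fields A. \<forall>Z\<in>vector_fields A. \<forall>p.
        X p (\<lambda>q. g q (Y q) (Z q)) = g p (D X Y p) (Z p) + g p (Y p) (D X Z p))"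

definition curvature ::
  "('m, 'e::euclidean_space) chart set \<Rightarrow> ('m vfield \<Rightarrow> 'm vfield \<Rightarrow> 'm vfield) \<Rightarrow>
   'm vfield \<Rightarrow> 'm vfield \<Rightarrow> 'm vfield \<Rightarrow> 'm vfield" where
  "curvature A D X Y Z = D X (D Y Z) - D Y (D X Z) - D (lie_bracket A X Y) Z"

text \<open>The trace at \<open>p\<close> of \<open>X \<mapsto> R(X,Y)Z\<close>.  Each tangent vector \<open>v\<close> at \<open>p\<close> is extended to a
  global vector field; since curvature is tensorial, the value at \<open>p\<close> depends on \<open>v\<close> only.\<close>

definition ricci ::
  "('m, 'e::euclidean_space) chart set \<Rightarrow> ('m vfield \<Rightarrow> 'm vfield \<Rightarrow> 'm vfield) \<Rightarrow>
   'm vfield \<Rightarrow> 'm vfield \<Rightarrow> 'm \<Rightarrow> real" where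
  "ricci A D Y Z p =
     trace_on (tangent_space A p)
       (\<lambda>v. curvature A D (SOME X. X \<in> vector_fields A \<and> X p = v) Y Z p)"

definition lie_derivative_metric ::
  "('m, 'e::euclidean_space) chart set \<Rightarrow> ('m \<Rightarrow> 'm tangent \<Rightarrow> 'm tangent \<Rightarrow> real) \<Rightarrow>
   'm vfield \<Rightarrow> 'm vfield \<Rightarrow> 'm vfield \<Rightarrow> 'm \<Rightarrow> real" where
  "lie_derivative_metric A g V X Y p =
     V p (\<lambda>q. g q (X q) (Y q)) - g p (lie_bracket A V X p) (Y p) - g p (X p) (lie_bracket A V Y p)"

definition almost_paracontact_metric ::
  "('m, 'e::euclidean_space) chart set \<Rightarrow> ('m \<Rightarrow> 'm tangent \<Rightarrow> 'm tangent) \<Rightarrow> 'm vfield \<Rightarrow>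
   ('m \<Rightarrow> 'm tangent \<Rightarrow> real) \<Rightarrow> ('m \<Rightarrow> 'm tangent \<Rightarrow> 'm tangent \<Rightarrow> real) \<Rightarrow> real \<Rightarrow> bool" where
  "almost_paracontact_metric A \<phi> \<xi> \<eta> g \<epsilon> \<longleftrightarrow>
     tensor_field_11 A \<phi> \<and> \<xi> \<in> vector_fields A \<and> one_form A \<eta> \<and>
     pseudo_riemannian_metric A g \<and> \<epsilon> \<in> {1, -1} \<and>
     (\<forall>X\<in>vector_fields A. \<forall>p. \<phi> p (\<phi> p (X p)) = X p - \<eta> p (X p) *\<^sub>R \<xi> p) \<and>
     (\<forall>p. \<eta> p (\<xi> p) = 1) \<and>
     (\<forall>p. \<phi> p (\<xi> p) = 0) \<and>
     (\<forall>X\<in>vector_fields A. \<forall>p. \<eta> p (\<phi> p (X p)) = 0) \<and>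
     (\<forall>X\<in>vector_fields A. \<forall>Y\<in>vector_fields A. \<forall>p.
        g p (\<phi> p (X p)) (\<phi> p (Y p)) = g p (X p) (Y p) - \<epsilon> * \<eta> p (X p) * \<eta> p (Y p))"

definition einstein_like ::
  "('m, 'e::euclidean_space) chart set \<Rightarrow> ('m \<Rightarrow> 'm tangent \<Rightarrow> 'm tangent) \<Rightarrow>
   ('m \<Rightarrow> 'm tangent \<Rightarrow> real) \<Rightarrow> ('m \<Rightarrow> 'm tangent \<Rightarrow> 'm tangent \<Rightarrow> real) \<Rightarrow>
   ('m vfield \<Rightarrow> 'm vfield \<Rightarrow> 'm vfield) \<Rightarrow> real \<Rightarrow> real \<Rightarrow> real \<Rightarrow> bool" where
  "einstein_like A \<phi> \<eta> g D a b c \<longleftrightarrow>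
     (\<forall>X\<in>vector_fields A. \<forall>Y\<in>vector_fields A. \<forall>p.
        ricci A D X Y p =
          a * g p (X p) (Y p) + b * g p (\<phi> p (X p)) (Y p) + c * \<eta> p (X p) * \<eta> p (Y p))"

definition eta_einstein ::
  "('m, 'e::euclidean_space) chart set \<Rightarrow> ('m \<Rightarrow> 'm tangent \<Rightarrow> real) \<Rightarrow>
   ('m \<Rightarrow> 'm tangent \<Rightarrow> 'm tangent \<Rightarrow> real) \<Rightarrow> ('m vfield \<Rightarrow> 'm vfield \<Rightarrow> 'm vfield) \<Rightarrow> bool" where
  "eta_einstein A \<eta> g D \<longleftrightarrow>
     (\<exists>a c. \<forall>X\<in>vector_fields A. \<forall>Y\<in>vector_fields A. \<forall>p.
        ricci A D X Y p = a * g p (X p) (Y p) + c * \<eta> p (X p) * \<eta> p (Y p))"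

definition eta_ricci_soliton ::
  "('m, 'e::euclidean_space) chart set \<Rightarrow> ('m \<Rightarrow> 'm tangent \<Rightarrow> real) \<Rightarrow>
   ('m vfield \<Rightarrow> 'm vfield \<Rightarrow> 'm vfield) \<Rightarrow>
   ('m \<Rightarrow> 'm tangent \<Rightarrow> 'm tangent \<Rightarrow> real) \<Rightarrow> 'm vfield \<Rightarrow> real \<Rightarrow> real \<Rightarrow> bool" where
  "eta_ricci_soliton A \<eta> D g \<xi> l \<mu> \<longleftrightarrow>
     (\<forall>X\<in>vector_fields A. \<forall>Y\<in>vector_fields A. \<forall>p.
        1 / 2 * lie_derivative_metric A g \<xi> X Y p + ricci A D X Y p
          + l * g p (X p) (Y p) + \<mu> * \<eta> p (X p) * \<eta> p (Y p) = 0)"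

definition torse_forming ::
  "('m, 'e::euclidean_space) chart set \<Rightarrow> ('m vfield \<Rightarrow> 'm vfield \<Rightarrow> 'm vfield) \<Rightarrow> 'm vfield \<Rightarrow> bool"
  where
  "torse_forming A D \<xi> \<longleftrightarrow>
     (\<exists>f\<in>smooth_functions A. \<exists>w. one_form A w \<and>
        (\<forall>X\<in>vector_fields A. \<forall>p. D X \<xi> p = f p *\<^sub>R X p + w p (X p) *\<^sub>R \<xi> p))"

end

theory Submission
  imports Defs
begin

text \<open>Write \<open>G = g - \<epsilon> \<eta> \<otimes> \<eta>\<close> and \<open>n = dim M\<close>.  As \<open>\<xi>\<close> has constant length, the torse-forming
  condition reads \<open>\<nabla>\<^sub>X \<xi> = f (X - \<eta>(X) \<xi>)\<close>, so that \<open>L\<^sub>\<xi> g = 2 f G\<close>.  Put \<open>h = f + a + l\<close>.  The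
  soliton equation and the Einstein-like equation give \<open>h G(X,Y) + b g(\<phi>X,Y) = 0\<close>; with \<open>\<phi>X\<close> in the
  place of \<open>X\<close> this becomes \<open>h g(\<phi>X,Y) + b G(X,Y) = 0\<close>, whence \<open>(h\<^sup>2 - b\<^sup>2) G = 0\<close>.  The first of these
  equations also turns the Einstein-like equation into
  \<open>S = (a - h) g + (c + \<epsilon> h) \<eta> \<otimes> \<eta>\<close>, and what has to be shown is that \<open>h\<close> is constant.

  If \<open>b = 0\<close>, or if \<open>n = 1\<close> and hence \<open>G = 0\<close>, the middle term of the Einstein-like equation vanishes
  and nothing is left to do.  Otherwise \<open>G\<close> is nonzero at every point, so \<open>h\<^sup>2 = b\<^sup>2\<close> everywhere; hence
  \<open>h\<close> and \<open>f\<close> have zero derivative, and on a connected manifold the proof would be finished.  On a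
  disconnected one, \<open>h = b\<close> at one point and \<open>h = -b\<close> at another has to be excluded, and for this the
  curvature is needed.

  Let \<open>\<alpha> = a - h\<close> and \<open>\<gamma> = c + \<epsilon> h\<close>.  From \<open>R(X,\<xi>)\<xi> = - f\<^sup>2 (X - \<eta>(X) \<xi>)\<close> one obtains
  \<open>\<epsilon> a + c = \<epsilon> \<alpha> + \<gamma> = - (n - 1) f\<^sup>2\<close>, so \<open>f\<^sup>2\<close> is a constant (\<open>ricci_xi_xi\<close>).  The Lie derivative of
  the connection along \<open>\<xi>\<close> is \<open>(X,Y) \<mapsto> - 2 \<epsilon> f\<^sup>2 G(X,Y) \<xi>\<close> (\<open>lie_D\<close>), which determines \<open>L\<^sub>\<xi> R\<close>
  (\<open>lie_R\<close>) and, after taking a trace, \<open>L\<^sub>\<xi> S = - 2 \<epsilon> (n - 1) f\<^sup>3 G\<close>.  On the other hand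
  \<open>S = \<alpha> g + \<gamma> \<eta> \<otimes> \<eta>\<close> gives \<open>L\<^sub>\<xi> S = 2 f \<alpha> G\<close>.  Together these yield \<open>f \<gamma> = 0\<close>
  (\<open>ricci_rigidity\<close>).  If \<open>h\<close> took both values \<open>\<plusminus>b\<close>, then \<open>f\<close> would vanish at neither point, because
  \<open>f\<^sup>2\<close> is constant and \<open>f\<close> is not; so \<open>\<gamma> = c \<plusminus> \<epsilon> b\<close> would vanish at both, contradicting
  \<open>b \<noteq> 0\<close>.

  The Ricci tensor is a trace over the space of derivations at a point, computed with extensions of
  tangent vectors to vector fields.  To evaluate it one needs that derivations are combinations of
  coordinate derivations and that these extend globally, that is, Hadamard's lemma and bump functions;
  to differentiate it along \<open>\<xi>\<close> one needs that the trace commutes with the Lie derivative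
  (\<open>deriv_tr\<close>).\<close>

section \<open>Calculus of smooth functions on open sets\<close>

lemma Ck_on_cong:
  assumes "open S" "\<And>x. x \<in> S \<Longrightarrow> f x = g x" "Ck_on k S f"
  shows "Ck_on k S g"
  using assms(2,3)
proof (induction k arbitrary: f g)
  case 0
  then show ?case by (metis Ck_on.simps(1) continuous_on_cong)
next
  case (Suc k)
  have d: "g differentiable (at x)" if "x \<in> S" for x
    using Suc.prems that assms(1)
    by (metis Ck_on.simps(2) differentiable_def has_derivative_transform_within_open)
  have e: "frechet_derivative f (at x) = frechet_derivative g (at x)" if "x \<in> S" for x
    using Suc.prems that assms(1) frechet_derivative_transform_within_open[of f x S g] by auto
  show ?case
    using d e Suc.prems Suc.IH[of "\<lambda>x. frechet_derivative f (at x) i"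
        "\<lambda>x. frechet_derivative g (at x) i" for i] by auto
qed

lemma Ck_on_subset: "Ck_on k S f \<Longrightarrow> T \<subseteq> S \<Longrightarrow> Ck_on k T f"
  by (induction k arbitrary: f) (auto intro: continuous_on_subset)

lemma Ck_on_Suc_imp: "Ck_on (Suc k) S f \<Longrightarrow> Ck_on k S f"
proof (induction k arbitrary: f)
  case 0
  then show ?case
    by (auto intro!: continuous_at_imp_continuous_on differentiable_imp_continuous_within)
next
  case (Suc k)
  then show ?case by auto
qed

lemma Ck_on_local:
  assumes "\<And>x. x \<in> S \<Longrightarrow> \<exists>T. open T \<and> x \<in> T \<and> Ck_on k T f"
  shows "Ck_on k S f"
  using assms
proof (induction k arbitrary: f)
  case 0
  then show ?case
    by (metis Ck_on.simps(1) continuous_at_imp_continuous_on continuous_on_eq_continuous_at)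
next
  case (Suc k)
  show ?case
  proof (simp, intro conjI ballI)
    fix x assume "x \<in> S"
    then show "f differentiable (at x)" using Suc.prems by (metis Ck_on.simps(2))
  next
    fix i :: 'a assume i: "i \<in> Basis"
    show "Ck_on k S (\<lambda>x. frechet_derivative f (at x) i)"
      by (rule Suc.IH) (use Suc.prems i in \<open>metis Ck_on.simps(2)\<close>)
  qed
qed

text \<open>The induction step of every closure property below: a derivative given in closed form may be
  used in place of the one that the definition picks.\<close>

lemma Ck_on_SucI:
  assumes "open S"
    and "\<And>x. x \<in> S \<Longrightarrow> (f has_derivative f' x) (at x)"
    and "\<And>i. i \<in> Basis \<Longrightarrow> Ck_on k S (\<lambda>x. f' x i)"
  shows "Ck_on (Suc k) S f"
proof (simp, intro conjI ballI)
  fix x assume "x \<in> S"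
  then show "f differentiable (at x)" using assms(2) by (auto simp: differentiable_def)
next
  fix i :: 'a assume "i \<in> Basis"
  moreover have "f' x i = frechet_derivative f (at x) i" if "x \<in> S" for x
    using frechet_derivative_at[OF assms(2)[OF that]] by simp
  ultimately show "Ck_on k S (\<lambda>x. frechet_derivative f (at x) i)"
    using Ck_on_cong[OF assms(1), of "\<lambda>x. f' x i" "\<lambda>x. frechet_derivative f (at x) i" k] assms(3)
    by blast
qed

lemma Ck_on_SucD:
  assumes "Ck_on (Suc k) S f" "x \<in> S"
  shows "(f has_derivative frechet_derivative f (at x)) (at x)"
  using assms by (auto simp: frechet_derivative_works)

lemma Ck_on_SucD':
  "Ck_on (Suc k) S f \<Longrightarrow> i \<in> Basis \<Longrightarrow> Ck_on k S (\<lambda>x. frechet_derivative f (at x) i)"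
  by simp

lemma Ck_on_const: "open S \<Longrightarrow> Ck_on k S (\<lambda>x. c)"
proof (induction k arbitrary: c)
  case (Suc k)
  show ?case by (rule Ck_on_SucI[OF Suc.prems has_derivative_const Suc.IH[OF Suc.prems]])
qed simp

lemma Ck_on_add:
  assumes "open S" "Ck_on k S f" "Ck_on k S g"
  shows "Ck_on k S (\<lambda>x. f x + g x)"
  using assms(2,3)
proof (induction k arbitrary: f g)
  case (Suc k)
  show ?case
    by (rule Ck_on_SucI[OF assms(1) has_derivative_add[OF Ck_on_SucD[OF Suc.prems(1)]
            Ck_on_SucD[OF Suc.prems(2)]] Suc.IH[OF Ck_on_SucD'[OF Suc.prems(1)] Ck_on_SucD'[OF Suc.prems(2)]]])
qed (auto intro: continuous_intros)

lemma Ck_on_linear: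
  assumes "open S" "bounded_linear T" "Ck_on k S f"
  shows "Ck_on k S (\<lambda>x. T (f x))"
  using assms(3)
proof (induction k arbitrary: f)
  case 0
  then show ?case by (simp add: bounded_linear.continuous_on[OF assms(2)])
next
  case (Suc k)
  show ?case
    by (rule Ck_on_SucI[OF assms(1) bounded_linear.has_derivative[OF assms(2) Ck_on_SucD[OF Suc.prems]]
          Suc.IH[OF Ck_on_SucD'[OF Suc.prems]]])
qed

lemma Ck_on_scaleR:
  fixes f :: "'e::euclidean_space \<Rightarrow> real" and g :: "'e \<Rightarrow> 'f::real_normed_vector"
  assumes "open S" "Ck_on k S f" "Ck_on k S g"
  shows "Ck_on k S (\<lambda>x. f x *\<^sub>R g x)"
  using assms(2,3)
proof (induction k arbitrary: f g)
  case (Suc k)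
  show ?case
  proof (rule Ck_on_SucI[OF assms(1) has_derivative_scaleR])
    fix i :: 'e assume i: "i \<in> Basis"
    note s = Ck_on_Suc_imp[OF Suc.prems(1)] Ck_on_Suc_imp[OF Suc.prems(2)]
    show "Ck_on k S (\<lambda>x. f x *\<^sub>R frechet_derivative g (at x) i + frechet_derivative f (at x) i *\<^sub>R g x)"
      by (intro Ck_on_add[OF assms(1)] Suc.IH s Ck_on_SucD'[OF Suc.prems(1) i] Ck_on_SucD'[OF Suc.prems(2) i])
  qed (rule Ck_on_SucD[OF Suc.prems(1)] Ck_on_SucD[OF Suc.prems(2)], assumption)+
qed (auto intro: continuous_intros)

lemma Ck_on_mult:
  fixes f g :: "'e::euclidean_space \<Rightarrow> real"
  assumes "open S" "Ck_on k S f" "Ck_on k S g"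
  shows "Ck_on k S (\<lambda>x. f x * g x)"
  using Ck_on_scaleR[OF assms] by simp

lemma Ck_on_sum:
  assumes "open S" "\<And>j. j \<in> J \<Longrightarrow> Ck_on k S (f j)"
  shows "Ck_on k S (\<lambda>x. \<Sum>j\<in>J. f j x)"
  using assms(2)
proof (induction J rule: infinite_finite_induct)
  case (insert j J)
  then show ?case using Ck_on_add[OF assms(1), of k "f j" "\<lambda>x. \<Sum>j\<in>J. f j x"] by simp
qed (simp_all add: Ck_on_const[OF assms(1)])

lemma Ck_on_compose:
  fixes g :: "'d::euclidean_space \<Rightarrow> 'e::euclidean_space" and f :: "'e \<Rightarrow> 'f::real_normed_vector"
  assumes "open S" "open T" "Ck_on k S g" "Ck_on k T f" "g ` S \<subseteq> T"
  shows "Ck_on k S (\<lambda>x. f (g x))"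
  using assms(3,4)
proof (induction k arbitrary: f)
  case 0
  then show ?case using assms(5) by (auto intro: continuous_on_compose2)
next
  case (Suc k)
  have gk: "Ck_on k S g" using Ck_on_Suc_imp[OF Suc.prems(1)] .
  show ?case
  proof (rule Ck_on_SucI[OF assms(1)])
    fix x assume x: "x \<in> S"
    then have gx: "g x \<in> T" using assms(5) by auto
    have lin: "linear (frechet_derivative f (at (g x)))"
      using Ck_on_SucD[OF Suc.prems(2) gx] has_derivative_linear by blast
    have "((\<lambda>x. f (g x)) has_derivative (\<lambda>h. frechet_derivative f (at (g x)) (frechet_derivative g (at x) h))) (at x)"
      by (rule has_derivative_compose[OF Ck_on_SucD[OF Suc.prems(1) x] Ck_on_SucD[OF Suc.prems(2) gx]])
    moreover have "frechet_derivative f (at (g x)) (frechet_derivative g (at x) h) =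
      (\<Sum>j\<in>Basis. (frechet_derivative g (at x) h \<bullet> j) *\<^sub>R frechet_derivative f (at (g x)) j)" for h
    proof -
      have "frechet_derivative f (at (g x)) (frechet_derivative g (at x) h) =
        frechet_derivative f (at (g x)) (\<Sum>j\<in>Basis. (frechet_derivative g (at x) h \<bullet> j) *\<^sub>R j)"
        by (simp add: euclidean_representation)
      also have "\<dots> = (\<Sum>j\<in>Basis. (frechet_derivative g (at x) h \<bullet> j) *\<^sub>R frechet_derivative f (at (g x)) j)"
        using lin by (simp add: linear_sum linear_scale)
      finally show ?thesis .
    qed
    ultimately show "((\<lambda>x. f (g x)) has_derivative (\<lambda>h.
      \<Sum>j\<in>Basis. (frechet_derivative g (at x) h \<bullet> j) *\<^sub>R frechet_derivative f (at (g x)) j)) (at x)"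
      by simp
  next
    fix i :: 'd assume i: "i \<in> Basis"
    show "Ck_on k S (\<lambda>x. \<Sum>j\<in>Basis. (frechet_derivative g (at x) i \<bullet> j) *\<^sub>R frechet_derivative f (at (g x)) j)"
      by (intro Ck_on_sum Ck_on_scaleR assms(1) Suc.IH gk
          Ck_on_linear[OF assms(1) bounded_linear_inner_left] Ck_on_SucD'[OF Suc.prems(1) i]
          Ck_on_SucD'[OF Suc.prems(2)])
  qed
qed

lemma Ck_on_ident:
  fixes S :: "'e::euclidean_space set"
  assumes "open S"
  shows "Ck_on k S (\<lambda>x. x)"
proof (cases k)
  case (Suc k')
  then show ?thesis
    by (auto intro!: Ck_on_SucI[OF assms has_derivative_ident] Ck_on_const assms)
qed simp

lemma smooth_on_cong: "open S \<Longrightarrow> (\<And>x. x \<in> S \<Longrightarrow> f x = g x) \<Longrightarrow> smooth_on S f \<Longrightarrow> smooth_on S g"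
  unfolding smooth_on_def using Ck_on_cong by blast

lemma smooth_on_subset: "smooth_on S f \<Longrightarrow> T \<subseteq> S \<Longrightarrow> smooth_on T f"
  unfolding smooth_on_def using Ck_on_subset by blast

lemma smooth_on_local:
  assumes "\<And>x. x \<in> S \<Longrightarrow> \<exists>T. open T \<and> x \<in> T \<and> smooth_on T f"
  shows "smooth_on S f"
  unfolding smooth_on_def by (intro allI Ck_on_local) (use assms in \<open>unfold smooth_on_def, blast\<close>)

lemma smooth_on_const: "open S \<Longrightarrow> smooth_on S (\<lambda>x. c)"
  by (simp add: smooth_on_def Ck_on_const)

lemma smooth_on_ident: "open S \<Longrightarrow> smooth_on S (\<lambda>x::'e::euclidean_space. x)"
  by (simp add: smooth_on_def Ck_on_ident)

lemma smooth_on_add: "open S \<Longrightarrow> smooth_on S f \<Longrightarrow> smooth_on S g \<Longrightarrow> smooth_on S (\<lambda>x. f x + g x)"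
  by (simp add: smooth_on_def Ck_on_add)

lemma smooth_on_mult:
  "open S \<Longrightarrow> smooth_on S f \<Longrightarrow> smooth_on S g \<Longrightarrow> smooth_on S (\<lambda>x. f x * g x :: real)"
  by (simp add: smooth_on_def Ck_on_mult)

lemma smooth_on_sum:
  "open S \<Longrightarrow> (\<And>j. j \<in> J \<Longrightarrow> smooth_on S (f j)) \<Longrightarrow> smooth_on S (\<lambda>x. \<Sum>j\<in>J. f j x)"
  by (simp add: smooth_on_def Ck_on_sum)

lemma smooth_on_linear:
  "open S \<Longrightarrow> bounded_linear T \<Longrightarrow> smooth_on S f \<Longrightarrow> smooth_on S (\<lambda>x. T (f x))"
  by (simp add: smooth_on_def Ck_on_linear)

lemma smooth_on_compose:
  fixes g :: "'d::euclidean_space \<Rightarrow> 'e::euclidean_space"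
  assumes "open S" "open T" "smooth_on S g" "smooth_on T f" "g ` S \<subseteq> T"
  shows "smooth_on S (\<lambda>x. f (g x))"
  using assms by (auto simp: smooth_on_def intro: Ck_on_compose)

lemma smooth_on_has_derivative:
  "smooth_on S f \<Longrightarrow> x \<in> S \<Longrightarrow> (f has_derivative frechet_derivative f (at x)) (at x)"
  unfolding smooth_on_def using Ck_on_SucD by blast

lemma smooth_on_partial:
  "smooth_on S f \<Longrightarrow> i \<in> Basis \<Longrightarrow> smooth_on S (\<lambda>x. frechet_derivative f (at x) i)"
  unfolding smooth_on_def using Ck_on_SucD' by blast

section \<open>A smooth cutoff function\<close>

text \<open>The functions \<open>t\<^bsup>-n\<^esup> exp (-1/t)\<close>, continued by \<open>0\<close> to \<open>t \<le> 0\<close>, have derivatives that are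
  linear combinations of functions of the same kind, so one induction shows that all of them are
  smooth.\<close>

definition flat :: "nat \<Rightarrow> real \<Rightarrow> real" where
  "flat n t = (if t \<le> 0 then 0 else inverse t ^ n * exp (- inverse t))"

lemma DERIV_inverse_power:
  fixes t :: real
  assumes "t \<noteq> 0"
  shows "((\<lambda>t. inverse t ^ n) has_real_derivative - (n * inverse t ^ (n + 1))) (at t)"
proof (induction n)
  case (Suc n)
  have "((\<lambda>t. inverse t * inverse t ^ n) has_real_derivative
      inverse t * - (n * inverse t ^ (n + 1)) + - (inverse t * 1 * inverse t) * inverse t ^ n) (at t)"
    using assms by (intro DERIV_mult' Suc DERIV_inverse' DERIV_ident)
  then show ?case by (simp add: algebra_simps)
qed simp

lemma flat_has_derivative:
  "(flat n has_real_derivative (flat (n + 2) t - n * flat (n + 1) t)) (at t)"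
proof -
  consider "t < 0" | "t > 0" | "t = 0" by linarith
  then show ?thesis
  proof cases
    case 1
    have "((\<lambda>_. 0) has_real_derivative 0) (at t)" by simp
    then have "(flat n has_real_derivative 0) (at t)"
      by (rule has_field_derivative_transform_within_open[where S="{..<0}"])
         (use 1 in \<open>auto simp: flat_def\<close>)
    then show ?thesis using 1 by (simp add: flat_def)
  next
    case 2
    have "((\<lambda>t. inverse t ^ n * exp (- inverse t)) has_real_derivative
        inverse t ^ n * (exp (- inverse t) * - (- (inverse t * 1 * inverse t)))
          + - (n * inverse t ^ (n + 1)) * exp (- inverse t)) (at t)"
      using 2
      by (intro DERIV_mult' DERIV_inverse_power DERIV_fun_exp DERIV_minus DERIV_inverse' DERIV_ident)
         auto
    then have "((\<lambda>t. inverse t ^ n * exp (- inverse t)) has_real_derivative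
        (flat (n + 2) t - n * flat (n + 1) t)) (at t)"
      using 2 by (simp add: flat_def algebra_simps)
    then show ?thesis
      by (rule has_field_derivative_transform_within_open[where S="{0<..}"])
         (use 2 in \<open>auto simp: flat_def\<close>)
  next
    case 3
    have "((\<lambda>h. inverse h * flat n h) \<longlongrightarrow> 0) (at 0)"
    proof (rule filterlim_split_at)
      show "((\<lambda>h. inverse h * flat n h) \<longlongrightarrow> 0) (at_left 0)"
        by (rule tendsto_eventually)
           (auto simp: flat_def eventually_at_filter)
      have "((\<lambda>s::real. s ^ (n + 1) / exp s) \<longlongrightarrow> 0) at_top"
        by (rule tendsto_power_div_exp_0)
      then have "((\<lambda>h. inverse h ^ (n + 1) / exp (inverse h)) \<longlongrightarrow> 0) (at_right (0::real))"
        by (rule filterlim_compose[OF _ filterlim_inverse_at_top_right])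
      then show "((\<lambda>h. inverse h * flat n h) \<longlongrightarrow> 0) (at_right 0)"
        by (rule Lim_transform_eventually)
           (auto simp: eventually_at_filter flat_def exp_minus field_simps)
    qed
    then show ?thesis
      using 3 by (simp add: DERIV_def flat_def divide_inverse mult.commute)
  qed
qed

lemma smooth_on_flat: "smooth_on UNIV (flat n)"
proof -
  have "Ck_on k UNIV (flat n)" for k
  proof (induction k arbitrary: n)
    case 0
    then show ?case
      by (auto intro!: continuous_at_imp_continuous_on DERIV_isCont[OF flat_has_derivative])
  next
    case (Suc k)
    show ?case
    proof (rule Ck_on_SucI[OF open_UNIV flat_has_derivative[unfolded has_field_derivative_def]])
      fix i :: real
      have "Ck_on k UNIV (\<lambda>t. (flat (n + 2) t + (- n) * flat (n + 1) t) * i)"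
        by (intro Ck_on_mult Ck_on_add Ck_on_const Suc.IH open_UNIV)
      then show "Ck_on k UNIV (\<lambda>t. (flat (n + 2) t - n * flat (n + 1) t) * i)" by simp
    qed
  qed
  then show ?thesis by (simp add: smooth_on_def)
qed

lemma smooth_on_inverse: "smooth_on {0<..} (inverse :: real \<Rightarrow> real)"
proof -
  have "Ck_on k {0<..} (\<lambda>t::real. c * inverse t ^ n)" for k n c
  proof (induction k arbitrary: n c)
    case 0
    then show ?case by (auto intro!: continuous_intros)
  next
    case (Suc k)
    show ?case
    proof (rule Ck_on_SucI[OF open_greaterThan])
      fix t :: real assume "t \<in> {0<..}"
      then show "((\<lambda>t. c * inverse t ^ n) has_derivative (\<lambda>h. (- c * n * h) * inverse t ^ (n + 1))) (at t)"
        using DERIV_cmult[OF DERIV_inverse_power[of t n], of c]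
        by (auto simp: has_field_derivative_def fun_eq_iff mult_ac elim!: has_derivative_eq_rhs)
    qed (rule Suc.IH)
  qed
  from this[of _ 1 1] show ?thesis by (simp add: smooth_on_def)
qed

text \<open>With \<open>e = flat 0\<close> the function is \<open>u / (u + v)\<close> for \<open>u = e(R\<^sup>2 - \<bar>x - x0\<bar>\<^sup>2)\<close> and
  \<open>v = e(\<bar>x - x0\<bar>\<^sup>2 - r\<^sup>2)\<close>, which have no common zero.\<close>

lemma smooth_cutoff_exists:
  fixes x0 :: "'e::euclidean_space"
  assumes "0 < r" "r < R"
  obtains \<beta> :: "'e \<Rightarrow> real" where "smooth_on UNIV \<beta>"
    "\<And>x. x \<in> ball x0 r \<Longrightarrow> \<beta> x = 1" "\<And>x. x \<notin> cball x0 R \<Longrightarrow> \<beta> x = 0"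
proof -
  define n where "n x = (x - x0) \<bullet> (x - x0)" for x
  define u where "u x = flat 0 (R\<^sup>2 - n x)" for x
  define v where "v x = flat 0 (n x - r\<^sup>2)" for x
  have rR: "r\<^sup>2 < R\<^sup>2" using assms by (simp add: power_strict_mono)
  have n_eq: "n x = (\<Sum>j\<in>Basis. ((x + - x0) \<bullet> j) * ((x + - x0) \<bullet> j))" for x
    unfolding n_def by (subst euclidean_inner) simp
  have sn: "smooth_on UNIV n"
    unfolding n_eq[abs_def]
    by (intro smooth_on_sum smooth_on_mult smooth_on_add smooth_on_const smooth_on_ident open_UNIV
        smooth_on_linear[OF open_UNIV bounded_linear_inner_left])
  have su: "smooth_on UNIV u"
    unfolding u_def
    by (rule smooth_on_compose[OF open_UNIV open_UNIV _ smooth_on_flat])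
       (use smooth_on_add[OF open_UNIV smooth_on_const[of UNIV "R\<^sup>2"]
             smooth_on_mult[OF open_UNIV smooth_on_const[of UNIV "-1"] sn]] in auto)
  have sv: "smooth_on UNIV v"
    unfolding v_def
    by (rule smooth_on_compose[OF open_UNIV open_UNIV _ smooth_on_flat])
       (use smooth_on_add[OF open_UNIV sn smooth_on_const[of UNIV "-(r\<^sup>2)"]] in auto)
  have pos: "u x + v x > 0" for x
    using rR by (auto simp: u_def v_def flat_def add_pos_pos)
  have s: "smooth_on UNIV (\<lambda>x. u x * inverse (u x + v x))"
    by (intro smooth_on_mult su open_UNIV
        smooth_on_compose[OF open_UNIV open_greaterThan smooth_on_add[OF open_UNIV su sv] smooth_on_inverse])
       (use pos in auto)
  have nd: "n x = (dist x0 x)\<^sup>2" for x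
    by (simp add: n_def dist_norm power2_norm_eq_inner[symmetric] norm_minus_commute)
  show thesis
  proof
    fix x
    {
      assume "x \<in> ball x0 r"
      then have "n x < r\<^sup>2" unfolding nd by (simp add: power_strict_mono)
      then show "u x * inverse (u x + v x) = 1" using pos[of x] by (simp add: v_def flat_def)
    }
    {
      assume "x \<notin> cball x0 R"
      then have "R\<^sup>2 \<le> n x" unfolding nd using assms by (intro power_mono) auto
      then show "u x * inverse (u x + v x) = 0" by (simp add: u_def flat_def)
    }
  qed (rule s)
qed

section \<open>Hadamard's lemma\<close>

text \<open>The weight \<open>t ^ j\<close> is there for the induction: differentiation under the integral sign replaces
  \<open>g\<close> by a partial derivative and \<open>j\<close> by \<open>j + 1\<close>.\<close>

lemma Ck_on_radial_integral:
  fixes g :: "'e::euclidean_space \<Rightarrow> real"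
  assumes "Ck_on k (ball x0 r) g"
  shows "Ck_on k (ball x0 r) (\<lambda>x. integral (cbox 0 1) (\<lambda>t::real. t ^ j * g (x0 + t *\<^sub>R (x - x0))))"
  using assms
proof (induction k arbitrary: j g)
  have seg: "x0 + t *\<^sub>R (x - x0) \<in> ball x0 r" if "x \<in> ball x0 r" "t \<in> cbox 0 1" for x and t :: real
  proof -
    have "\<bar>t\<bar> * norm (x - x0) \<le> 1 * norm (x - x0)" using that by (intro mult_right_mono) auto
    then show ?thesis using that by (simp add: dist_norm norm_minus_commute)
  qed
  {
    case 0
    show ?case unfolding Ck_on.simps
    proof (rule integral_continuous_on_param)
      show "continuous_on (ball x0 r \<times> cbox 0 1) (\<lambda>(x, t::real). t ^ j * g (x0 + t *\<^sub>R (x - x0)))"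
        unfolding case_prod_beta using 0 seg
        by (auto intro!: continuous_intros continuous_on_compose2[of "ball x0 r" g])
    qed
  next
    case (Suc k)
    define G where "G x = Blinfun (frechet_derivative g (at x))" for x
    have G: "blinfun_apply (G x) = frechet_derivative g (at x)" if "x \<in> ball x0 r" for x
      unfolding G_def
      by (rule bounded_linear_Blinfun_apply[OF has_derivative_bounded_linear[OF Ck_on_SucD[OF Suc.prems that]]])
    have Gc: "continuous_on (ball x0 r) G"
    proof (rule continuous_on_blinfun_componentwise)
      fix i :: 'e assume i: "i \<in> Basis"
      have "Ck_on 0 (ball x0 r) (\<lambda>x. frechet_derivative g (at x) i)"
        using Ck_on_SucD'[OF Suc.prems i]
        by (induction k) (auto intro: Ck_on_Suc_imp simp del: Ck_on.simps)
      then have "continuous_on (ball x0 r) (\<lambda>x. frechet_derivative g (at x) i)" by simp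
      then show "continuous_on (ball x0 r) (\<lambda>x. blinfun_apply (G x) i)"
        by (rule continuous_on_eq) (simp only: G)
    qed
    define fx where "fx x t = t ^ (j + 1) *\<^sub>R G (x0 + t *\<^sub>R (x - x0))" for x and t :: real
    have fxc: "continuous_on (ball x0 r \<times> cbox 0 1) (\<lambda>(x, t). fx x t)"
      unfolding case_prod_beta fx_def using seg
      by (auto intro!: continuous_intros continuous_on_compose2[OF Gc])
    have gc: "continuous_on (ball x0 r) g"
      by (meson Suc.prems Ck_on_SucD continuous_at_imp_continuous_on has_derivative_continuous)
    show ?case
    proof (rule Ck_on_SucI[OF open_ball])
      fix x assume x: "x \<in> ball x0 r"
      have "((\<lambda>x. integral (cbox 0 1) (\<lambda>t::real. t ^ j * g (x0 + t *\<^sub>R (x - x0)))) has_derivative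
          integral (cbox 0 1) (fx x)) (at x within ball x0 r)"
      proof (rule leibniz_rule[OF _ _ fxc x convex_ball])
        fix x and t :: real assume x: "x \<in> ball x0 r" and t: "t \<in> cbox 0 1"
        have "((\<lambda>x. x0 + t *\<^sub>R (x - x0)) has_derivative (\<lambda>h. t *\<^sub>R h)) (at x within ball x0 r)"
          by (auto intro!: derivative_eq_intros)
        from has_derivative_compose[OF this Ck_on_SucD[OF Suc.prems seg[OF x t]]]
        have "((\<lambda>x. t ^ j * g (x0 + t *\<^sub>R (x - x0))) has_derivative
          (\<lambda>h. t ^ j * frechet_derivative g (at (x0 + t *\<^sub>R (x - x0))) (t *\<^sub>R h))) (at x within ball x0 r)"
          by (rule has_derivative_mult_right)
        moreover have "(\<lambda>h. t ^ j * frechet_derivative g (at (x0 + t *\<^sub>R (x - x0))) (t *\<^sub>R h)) = blinfun_apply (fx x t)"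
          unfolding fx_def by (simp add: fun_eq_iff G[OF seg[OF x t], symmetric] blinfun.bilinear_simps)
        ultimately show "((\<lambda>x. t ^ j * g (x0 + t *\<^sub>R (x - x0))) has_derivative blinfun_apply (fx x t)) (at x within ball x0 r)"
          by simp
      next
        fix x assume "x \<in> ball x0 r"
        then show "(\<lambda>t::real. t ^ j * g (x0 + t *\<^sub>R (x - x0))) integrable_on cbox 0 1"
          using seg by (intro integrable_continuous continuous_intros continuous_on_compose2[OF gc]) auto
      qed
      then show "((\<lambda>x. integral (cbox 0 1) (\<lambda>t::real. t ^ j * g (x0 + t *\<^sub>R (x - x0)))) has_derivative
          integral (cbox 0 1) (fx x)) (at x)"
        using x by (simp add: at_within_open[OF _ open_ball])
    next
      fix i :: 'e assume i: "i \<in> Basis"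
      have eq: "integral (cbox 0 1) (\<lambda>t::real. t ^ (j + 1) * frechet_derivative g (at (x0 + t *\<^sub>R (x - x0))) i)
          = integral (cbox 0 1) (fx x) i" if x: "x \<in> ball x0 r" for x
      proof -
        have "continuous_on (cbox 0 1) (\<lambda>t. (\<lambda>(x, t). fx x t) (x, t))"
          by (rule continuous_on_compose2[OF fxc]) (use x in \<open>auto intro: continuous_intros\<close>)
        then have "fx x integrable_on cbox 0 1"
          by (intro integrable_continuous) simp
        then have "integral (cbox 0 1) (fx x) i = integral (cbox 0 1) (\<lambda>t. fx x t i)"
          by (rule blinfun_apply_integral)
        also have "\<dots> = integral (cbox 0 1) (\<lambda>t::real. t ^ (j + 1) * frechet_derivative g (at (x0 + t *\<^sub>R (x - x0))) i)"
          by (rule integral_cong) (simp add: fx_def blinfun.bilinear_simps G[OF seg[OF x]])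
        finally show ?thesis by simp
      qed
      show "Ck_on k (ball x0 r) (\<lambda>x. integral (cbox 0 1) (fx x) i)"
        by (rule Ck_on_cong[OF open_ball eq Suc.IH[OF Ck_on_SucD'[OF Suc.prems i]]])
    qed
  }
qed

text \<open>By the fundamental theorem of calculus along the segment from \<open>x0\<close> to \<open>x\<close>, one may take for
  \<open>h i x\<close> the mean of the \<open>i\<close>-th partial derivative over that segment.\<close>

lemma hadamard:
  fixes f :: "'e::euclidean_space \<Rightarrow> real"
  assumes f: "smooth_on (ball x0 r) f" and r: "r > 0"
  obtains h where "\<And>i. i \<in> Basis \<Longrightarrow> smooth_on (ball x0 r) (h i)"
    "\<And>i. i \<in> Basis \<Longrightarrow> h i x0 = frechet_derivative f (at x0) i"
    "\<And>x. x \<in> ball x0 r \<Longrightarrow> f x = f x0 + (\<Sum>i\<in>Basis. ((x \<bullet> i) - (x0 \<bullet> i)) * h i x)"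
proof
  define h where "h i x = integral (cbox 0 1) (\<lambda>t::real. t ^ 0 * frechet_derivative f (at (x0 + t *\<^sub>R (x - x0))) i)" for i x
  show "smooth_on (ball x0 r) (h i)" if "i \<in> Basis" for i
    using smooth_on_partial[OF f that] unfolding smooth_on_def h_def
    by (intro allI Ck_on_radial_integral) blast
  show "h i x0 = frechet_derivative f (at x0) i" if "i \<in> Basis" for i
    by (simp add: h_def)
  show "f x = f x0 + (\<Sum>i\<in>Basis. ((x \<bullet> i) - (x0 \<bullet> i)) * h i x)" if x: "x \<in> ball x0 r" for x
  proof -
    have seg: "x0 + t *\<^sub>R (x - x0) \<in> ball x0 r" if "t \<in> cbox 0 1" for t :: real
    proof -
      have "\<bar>t\<bar> * norm (x - x0) \<le> 1 * norm (x - x0)" using that by (intro mult_right_mono) auto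
      then show ?thesis using x by (simp add: dist_norm norm_minus_commute)
    qed
    let ?D = "\<lambda>t::real. frechet_derivative f (at (x0 + t *\<^sub>R (x - x0)))"
    have lin: "?D t (x - x0) = (\<Sum>i\<in>Basis. ((x \<bullet> i) - (x0 \<bullet> i)) * ?D t i)" if t: "t \<in> cbox 0 1" for t
    proof -
      have l: "linear (?D t)"
        using smooth_on_has_derivative[OF f seg[OF t]] has_derivative_linear by blast
      have "?D t (x - x0) = ?D t (\<Sum>i\<in>Basis. ((x - x0) \<bullet> i) *\<^sub>R i)"
        by (simp add: euclidean_representation)
      also have "\<dots> = (\<Sum>i\<in>Basis. ((x - x0) \<bullet> i) *\<^sub>R ?D t i)"
        using l by (simp add: linear_sum linear_scale)
      finally show ?thesis by (simp add: inner_diff_left)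
    qed
    have int: "(\<lambda>t. ?D t i) integrable_on cbox 0 1" if i: "i \<in> Basis" for i
    proof -
      have c: "continuous_on (ball x0 r) (\<lambda>x. frechet_derivative f (at x) i)"
        using smooth_on_partial[OF f i] unfolding smooth_on_def by (metis Ck_on.simps(1))
      show ?thesis
        using seg by (intro integrable_continuous continuous_on_compose2[OF c] continuous_intros) auto
    qed
    have "((\<lambda>t. ?D t (x - x0)) has_integral f (x0 + 1 *\<^sub>R (x - x0)) - f (x0 + 0 *\<^sub>R (x - x0))) {0..1}"
    proof (rule fundamental_theorem_of_calculus)
      fix t :: real assume t: "t \<in> {0..1}"
      have a: "((\<lambda>t. x0 + t *\<^sub>R (x - x0)) has_derivative (\<lambda>s. s *\<^sub>R (x - x0))) (at t within {0..1})"
        by (auto intro!: derivative_eq_intros)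
      have b: "(f has_derivative ?D t) (at (x0 + t *\<^sub>R (x - x0)))"
        using smooth_on_has_derivative[OF f] seg t by auto
      have "linear (?D t)" using b has_derivative_linear by blast
      then show "((\<lambda>t. f (x0 + t *\<^sub>R (x - x0))) has_vector_derivative ?D t (x - x0)) (at t within {0..1})"
        using has_derivative_compose[OF a b] by (simp add: has_vector_derivative_def linear_scale)
    qed simp
    then have "f x - f x0 = integral (cbox 0 1) (\<lambda>t. ?D t (x - x0))"
      by (simp add: integral_unique)
    also have "\<dots> = integral (cbox 0 1) (\<lambda>t. \<Sum>i\<in>Basis. ((x \<bullet> i) - (x0 \<bullet> i)) * ?D t i)"
      by (rule integral_cong) (rule lin)
    also have "\<dots> = (\<Sum>i\<in>Basis. ((x \<bullet> i) - (x0 \<bullet> i)) * h i x)"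
      using int by (subst integral_sum) (auto simp: h_def integrable_on_mult_right)
    finally show ?thesis by simp
  qed
qed

section \<open>Smooth functions and tangent vectors\<close>

lemma sum_fun_apply: "(\<Sum>i\<in>I. F i) x = (\<Sum>i\<in>I. F i x)"
  by (induction I rule: infinite_finite_induct) auto

locale manifold =
  fixes A :: "('m::{t2_space,second_countable_topology}, 'e::euclidean_space) chart set"
  assumes atlas: "smooth_atlas A"
begin

abbreviation CM :: "('m \<Rightarrow> real) set" where "CM \<equiv> smooth_functions A"
abbreviation TM :: "'m \<Rightarrow> 'm tangent set" where "TM \<equiv> tangent_space A"
abbreviation XM :: "'m vfield set" where "XM \<equiv> vector_fields A"

lemma chart_at: obtains U x where "(U, x) \<in> A" "p \<in> U"
proof -
  have "p \<in> (\<Union>(U, x)\<in>A. U)" using atlas by (simp add: smooth_atlas_def)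
  then show thesis using that by auto
qed

lemma chartD:
  assumes "(U, x) \<in> A"
  shows "open U" "open (x ` U)" "continuous_on U x" "continuous_on (x ` U) (inv_into U x)"
    "q \<in> U \<Longrightarrow> inv_into U x (x q) = q"
    "z \<in> x ` U \<Longrightarrow> inv_into U x z \<in> U" "z \<in> x ` U \<Longrightarrow> x (inv_into U x z) = z"
proof -
  have h: "open U \<and> open (x ` U) \<and> homeomorphism U (x ` U) x (inv_into U x)"
    using atlas assms by (auto simp only: smooth_atlas_def split: prod.splits)
  then show "open U" "open (x ` U)" "continuous_on U x" "continuous_on (x ` U) (inv_into U x)"
    "q \<in> U \<Longrightarrow> inv_into U x (x q) = q"
    by (auto simp: homeomorphism_def)
  show "z \<in> x ` U \<Longrightarrow> inv_into U x z \<in> U" "z \<in> x ` U \<Longrightarrow> x (inv_into U x z) = z"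
    by (auto simp: inv_into_into f_inv_into_f)
qed

lemma transition_smooth:
  "(U, x) \<in> A \<Longrightarrow> (V, y) \<in> A \<Longrightarrow> smooth_on (x ` (U \<inter> V)) (y \<circ> inv_into U x)"
  using atlas by (fastforce simp only: smooth_atlas_def split: prod.splits)

lemma chart_preimage_open: "(U, x) \<in> A \<Longrightarrow> open W \<Longrightarrow> open {q \<in> U. x q \<in> W}"
  using continuous_open_preimage[OF chartD(3,1)] by (simp add: vimage_def Int_def)

lemma CM_I: "(\<And>U x. (U, x) \<in> A \<Longrightarrow> smooth_on (x ` U) (\<lambda>z. f (inv_into U x z))) \<Longrightarrow> f \<in> CM"
  by (auto simp: smooth_functions_def o_def)

lemma CM_D: "f \<in> CM \<Longrightarrow> (U, x) \<in> A \<Longrightarrow> smooth_on (x ` U) (\<lambda>z. f (inv_into U x z))"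
  by (auto simp: smooth_functions_def o_def)

lemma CM_const: "(\<lambda>_. c) \<in> CM"
  by (rule CM_I) (intro smooth_on_const chartD(2))

lemma CM_add: "f \<in> CM \<Longrightarrow> h \<in> CM \<Longrightarrow> (\<lambda>q. f q + h q) \<in> CM"
  by (rule CM_I) (intro smooth_on_add chartD(2) CM_D)

lemma CM_mult: "f \<in> CM \<Longrightarrow> h \<in> CM \<Longrightarrow> (\<lambda>q. f q * h q) \<in> CM"
  by (rule CM_I) (intro smooth_on_mult chartD(2) CM_D)

lemma CM_cmult: "f \<in> CM \<Longrightarrow> (\<lambda>q. c * f q) \<in> CM"
  by (rule CM_mult[OF CM_const])

lemma CM_uminus: "f \<in> CM \<Longrightarrow> (\<lambda>q. - f q) \<in> CM"
  using CM_cmult[of f "-1"] by simp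

lemma CM_diff: "f \<in> CM \<Longrightarrow> h \<in> CM \<Longrightarrow> (\<lambda>q. f q - h q) \<in> CM"
  using CM_add[OF _ CM_uminus, of f h] by simp

lemma CM_sum: "(\<And>j. j \<in> J \<Longrightarrow> f j \<in> CM) \<Longrightarrow> (\<lambda>q. \<Sum>j\<in>J. f j q) \<in> CM"
  by (induction J rule: infinite_finite_induct) (auto intro: CM_const CM_add)

text \<open>A smooth function on a coordinate domain becomes a global one after multiplication by a
  function with compact support: off that support, which is closed because \<open>M\<close> is Hausdorff, the
  extension vanishes.\<close>

lemma CM_cutoff:
  assumes ch: "(U, x) \<in> A" and W: "open W" "W \<subseteq> x ` U" and w: "smooth_on W w"
    and b: "smooth_on UNIV b" and K: "compact K" "K \<subseteq> W" and b0: "\<And>z. z \<notin> K \<Longrightarrow> b z = 0"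
  shows "(\<lambda>q. if q \<in> U then b (x q) * w (x q) else 0) \<in> CM" (is "?F \<in> CM")
proof (rule CM_I)
  fix V y assume ch': "(V, y) \<in> A"
  define L where "L = inv_into U x ` K"
  have "compact L" unfolding L_def
    using K W chartD(4)[OF ch] by (intro compact_continuous_image) (auto intro: continuous_on_subset)
  then have L: "open (- L)" using compact_imp_closed open_Compl by blast
  have L_iff: "q \<in> L \<longleftrightarrow> q \<in> U \<and> x q \<in> K" for q
  proof
    assume "q \<in> L"
    then obtain z where z: "z \<in> K" "q = inv_into U x z" by (auto simp: L_def)
    then have "z \<in> x ` U" using K W by blast
    then show "q \<in> U \<and> x q \<in> K" using chartD(6,7)[OF ch] z by metis
  next
    assume "q \<in> U \<and> x q \<in> K"
    then show "q \<in> L" unfolding L_def using chartD(5)[OF ch] by (metis imageI)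
  qed
  have op: "open (y ` V \<inter> inv_into V y -` N)" if "open N" for N
    using continuous_open_preimage[OF chartD(4,2)[OF ch'] that] .
  show "smooth_on (y ` V) (\<lambda>z. ?F (inv_into V y z))"
  proof (rule smooth_on_local)
    fix z assume z: "z \<in> y ` V"
    show "\<exists>T. open T \<and> z \<in> T \<and> smooth_on T (\<lambda>z. ?F (inv_into V y z))"
    proof (cases "inv_into V y z \<in> L")
      case True
      define T where "T = y ` V \<inter> inv_into V y -` {q \<in> U. x q \<in> W}"
      have oT: "open T" unfolding T_def using op chart_preimage_open[OF ch W(1)] by blast
      have zT: "z \<in> T" using True K z by (auto simp: T_def L_iff)
      have "T \<subseteq> y ` (V \<inter> U)"
      proof
        fix t assume t: "t \<in> T"
        then have "t = y (inv_into V y t)" "inv_into V y t \<in> V \<inter> U"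
          using chartD(6,7)[OF ch', of t] by (auto simp: T_def)
        then show "t \<in> y ` (V \<inter> U)" by blast
      qed
      then have t: "smooth_on T (\<lambda>z. x (inv_into V y z))"
        using smooth_on_subset[OF transition_smooth[OF ch' ch]] by (simp add: o_def)
      have "smooth_on T (\<lambda>z. b (x (inv_into V y z)) * w (x (inv_into V y z)))"
        by (intro smooth_on_mult oT smooth_on_compose[OF oT open_UNIV t b]
            smooth_on_compose[OF oT W(1) t w]) (auto simp: T_def)
      then have "smooth_on T (\<lambda>z. ?F (inv_into V y z))"
        by (rule smooth_on_cong[OF oT, rotated]) (simp add: T_def)
      then show ?thesis using oT zT by blast
    next
      case False
      define T where "T = y ` V \<inter> inv_into V y -` (- L)"
      have oT: "open T" unfolding T_def using op L by blast
      have "smooth_on T (\<lambda>z. ?F (inv_into V y z))"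
        by (rule smooth_on_cong[OF oT _ smooth_on_const[OF oT, of 0]])
           (auto simp: T_def L_iff b0)
      then show ?thesis using oT z False by (auto simp: T_def)
    qed
  qed
qed

lemma chart_cball:
  assumes "(U, x) \<in> A" "q \<in> U" "open N" "q \<in> N"
  obtains R where "R > 0" "cball (x q) R \<subseteq> x ` (U \<inter> N)"
proof -
  have "x ` (U \<inter> N) = x ` U \<inter> inv_into U x -` N"
  proof (intro equalityI subsetI)
    fix z assume "z \<in> x ` (U \<inter> N)"
    then show "z \<in> x ` U \<inter> inv_into U x -` N" using chartD(5)[OF assms(1)] by force
  next
    fix z assume z: "z \<in> x ` U \<inter> inv_into U x -` N"
    then have "z = x (inv_into U x z)" "inv_into U x z \<in> U \<inter> N"
      using chartD(6,7)[OF assms(1), of z] by auto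
    then show "z \<in> x ` (U \<inter> N)" by blast
  qed
  then have "open (x ` (U \<inter> N))"
    using continuous_open_preimage[OF chartD(4,2)[OF assms(1)] assms(3)] by simp
  moreover have "x q \<in> x ` (U \<inter> N)" using assms by blast
  ultimately show thesis using that open_contains_cball[of "x ` (U \<inter> N)"] by blast
qed

lemma bump_exists:
  assumes N: "open N" "p \<in> N"
  obtains \<psi> N' where "\<psi> \<in> CM" "open N'" "p \<in> N'" "\<And>q. q \<in> N' \<Longrightarrow> \<psi> q = 1"
    "\<And>q. q \<notin> N \<Longrightarrow> \<psi> q = 0"
proof -
  obtain U x where ch: "(U, x) \<in> A" "p \<in> U" using chart_at .
  obtain R where R: "R > 0" "cball (x p) R \<subseteq> x ` (U \<inter> N)" using chart_cball[OF ch N] .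
  obtain b :: "'e \<Rightarrow> real" where b: "smooth_on UNIV b" "\<And>z. z \<in> ball (x p) (R / 2) \<Longrightarrow> b z = 1"
    "\<And>z. z \<notin> cball (x p) R \<Longrightarrow> b z = 0"
    by (rule smooth_cutoff_exists[of "R / 2" R "x p"]) (use R in auto)
  have s: "(\<lambda>q. if q \<in> U then b (x q) * 1 else 0) \<in> CM"
    by (rule CM_cutoff[OF ch(1) chartD(2)[OF ch(1)] subset_refl smooth_on_const[OF chartD(2)[OF ch(1)]]
          b(1) compact_cball _ b(3)]) (use R in blast)+
  show thesis
  proof
    show "open {q \<in> U. x q \<in> ball (x p) (R / 2)}" by (rule chart_preimage_open[OF ch(1) open_ball])
    fix q
    show "(if q \<in> U then b (x q) * 1 else 0) = 1" if "q \<in> {q \<in> U. x q \<in> ball (x p) (R / 2)}"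
      using that b(2) by simp
    show "(if q \<in> U then b (x q) * 1 else 0) = 0" if "q \<notin> N"
    proof -
      have "x q \<notin> cball (x p) R" if "q \<in> U"
      proof
        assume "x q \<in> cball (x p) R"
        then have "x q \<in> x ` (U \<inter> N)" using R(2) by (rule subsetD[rotated])
        then obtain q' where q': "x q = x q'" "q' \<in> U" "q' \<in> N" by (elim imageE IntE)
        have "q = q'"
          using arg_cong[OF q'(1), of "inv_into U x"]
          by (simp only: chartD(5)[OF ch(1) that] chartD(5)[OF ch(1) q'(2)])
        then show False using \<open>q \<notin> N\<close> q'(3) by simp
      qed
      then show ?thesis using b(3) by simp
    qed
    show "p \<in> {q \<in> U. x q \<in> ball (x p) (R / 2)}" using ch R by simp
  qed (rule s)
qed

lemma TM_I:
  assumes "\<And>f h. f \<in> CM \<Longrightarrow> h \<in> CM \<Longrightarrow> v (\<lambda>q. f q + h q) = v f + v h"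
    and "\<And>c f. f \<in> CM \<Longrightarrow> v (\<lambda>q. c * f q) = c * v f"
    and "\<And>f h. f \<in> CM \<Longrightarrow> h \<in> CM \<Longrightarrow> v (\<lambda>q. f q * h q) = v f * h p + f p * v h"
    and "\<And>f. f \<notin> CM \<Longrightarrow> v f = 0"
  shows "v \<in> TM p"
  unfolding tangent_space_def linear_on_subspace_def plus_fun_def scaleR_fun_def real_scaleR_def
  using assms by blast

lemma tangent_add:
  "v \<in> TM p \<Longrightarrow> f \<in> CM \<Longrightarrow> h \<in> CM \<Longrightarrow> v (\<lambda>q. f q + h q) = v f + v h"
  unfolding tangent_space_def linear_on_subspace_def plus_fun_def by blast

lemma tangent_cmult: "v \<in> TM p \<Longrightarrow> f \<in> CM \<Longrightarrow> v (\<lambda>q. c * f q) = c * v f"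
  unfolding tangent_space_def linear_on_subspace_def scaleR_fun_def real_scaleR_def by blast

lemma tangent_mult:
  "v \<in> TM p \<Longrightarrow> f \<in> CM \<Longrightarrow> h \<in> CM \<Longrightarrow> v (\<lambda>q. f q * h q) = v f * h p + f p * v h"
  unfolding tangent_space_def by blast

lemma tangent_off: "v \<in> TM p \<Longrightarrow> f \<notin> CM \<Longrightarrow> v f = 0"
  unfolding tangent_space_def by blast

lemma tangent_const:
  assumes "v \<in> TM p"
  shows "v (\<lambda>_. c) = 0"
proof -
  have "v (\<lambda>_. 1) = 0" using tangent_mult[OF assms CM_const[of 1] CM_const[of 1]] by simp
  then show ?thesis using tangent_cmult[OF assms CM_const[of 1], of c] by simp
qed

lemma tangent_uminus: "v \<in> TM p \<Longrightarrow> f \<in> CM \<Longrightarrow> v (\<lambda>q. - f q) = - v f"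
  using tangent_cmult[of v p f "-1"] by simp

lemma tangent_diff:
  "v \<in> TM p \<Longrightarrow> f \<in> CM \<Longrightarrow> h \<in> CM \<Longrightarrow> v (\<lambda>q. f q - h q) = v f - v h"
  using tangent_add[OF _ _ CM_uminus, of v p f h] by (simp add: tangent_uminus)

lemma tangent_sum:
  assumes "v \<in> TM p" "\<And>j. j \<in> J \<Longrightarrow> f j \<in> CM"
  shows "v (\<lambda>q. \<Sum>j\<in>J. f j q) = (\<Sum>j\<in>J. v (f j))"
  using assms(2)
proof (induction J rule: infinite_finite_induct)
  case (insert j J)
  then show ?case using tangent_add[OF assms(1), of "f j" "\<lambda>q. \<Sum>j\<in>J. f j q"] by (simp add: CM_sum)
qed (simp_all add: tangent_const[OF assms(1)])

text \<open>Apply the product rule to \<open>\<psi> (f - h) = 0\<close> with a bump function \<open>\<psi>\<close> supported in \<open>N\<close>.\<close>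

lemma tangent_local:
  assumes v: "v \<in> TM p" and f: "f \<in> CM" "h \<in> CM" and N: "open N" "p \<in> N" "\<And>q. q \<in> N \<Longrightarrow> f q = h q"
  shows "v f = v h"
proof -
  obtain \<psi> N' where psi: "\<psi> \<in> CM" "p \<in> N'" "\<And>q. q \<in> N' \<Longrightarrow> \<psi> q = 1" "\<And>q. q \<notin> N \<Longrightarrow> \<psi> q = 0"
    using bump_exists[OF N(1,2)] by metis
  have "\<psi> q * (f q - h q) = 0" for q by (cases "q \<in> N") (simp_all add: psi(4) N(3))
  then have "(\<lambda>q. \<psi> q * (f q - h q)) = (\<lambda>_. 0)" by (rule ext)
  then have "v (\<lambda>q. \<psi> q * (f q - h q)) = 0" by (simp only: tangent_const[OF v])
  then show ?thesis
    using tangent_mult[OF v psi(1) CM_diff[OF f]] psi(2,3) N(2,3) tangent_diff[OF v f] by simp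
qed

lemma TM_zero: "0 \<in> TM p"
  by (rule TM_I) simp_all

lemma TM_add:
  assumes "u \<in> TM p" "v \<in> TM p"
  shows "u + v \<in> TM p"
  by (rule TM_I)
     (simp_all add: tangent_add[OF assms(1)] tangent_add[OF assms(2)] tangent_cmult[OF assms(1)]
       tangent_cmult[OF assms(2)] tangent_mult[OF assms(1)] tangent_mult[OF assms(2)]
       tangent_off[OF assms(1)] tangent_off[OF assms(2)] algebra_simps)

lemma TM_scaleR:
  assumes "v \<in> TM p"
  shows "c *\<^sub>R v \<in> TM p"
  by (rule TM_I)
     (simp_all add: tangent_add[OF assms] tangent_cmult[OF assms] tangent_mult[OF assms]
       tangent_off[OF assms] algebra_simps)

lemma TM_diff: "u \<in> TM p \<Longrightarrow> v \<in> TM p \<Longrightarrow> u - v \<in> TM p"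
  using TM_add[of u p "(-1) *\<^sub>R v"] TM_scaleR[of v p "-1"] by simp

lemma TM_subspace: "subspace (TM p)"
  by (simp add: subspace_def TM_zero TM_add TM_scaleR)

lemma TM_sum: "(\<And>j. j \<in> J \<Longrightarrow> u j \<in> TM p) \<Longrightarrow> (\<Sum>j\<in>J. u j) \<in> TM p"
  by (rule subspace_sum[OF TM_subspace])

section \<open>Coordinate frames\<close>

text \<open>Coordinates \<open>y\<close> and their derivations \<open>E\<close>, both defined on all of \<open>M\<close> but dual to each other
  only on \<open>N\<close>.\<close>

definition coord_frame :: "('e \<Rightarrow> 'm vfield) \<Rightarrow> ('e \<Rightarrow> 'm \<Rightarrow> real) \<Rightarrow> 'm set \<Rightarrow> bool" where
  "coord_frame E y N \<longleftrightarrow> open N \<and> (\<forall>i\<in>Basis. E i \<in> XM \<and> y i \<in> CM) \<and>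
     (\<forall>q\<in>N. \<forall>i\<in>Basis. \<forall>j\<in>Basis. E i q (y j) = (if i = j then 1 else 0)) \<and>
     (\<forall>q\<in>N. \<forall>v\<in>TM q. v = (\<Sum>i\<in>Basis. v (y i) *\<^sub>R E i q))"

text \<open>Near \<open>q\<close>, Hadamard's lemma writes \<open>f = f(q) + \<Sum>\<^sub>i (y\<^sub>i - y\<^sub>i(q)) H\<^sub>i\<close> with \<open>H\<^sub>i(q) = E\<^sub>i f\<close> at
  \<open>q\<close>.  A derivation at \<open>q\<close> kills constants, so the product rule makes its value on \<open>f\<close> equal to
  \<open>\<Sum>\<^sub>i v(y\<^sub>i) E\<^sub>i f\<close>.  The coordinates, their derivations and the \<open>H\<^sub>i\<close> are cut off to become global
  objects.\<close>

lemma coord_frame_exists: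
  obtains E y N where "coord_frame E y N" "p \<in> N"
proof -
  obtain U x where ch: "(U, x) \<in> A" "p \<in> U" using chart_at .
  note c = chartD[OF ch(1)]
  obtain R where R: "R > 0" "cball (x p) R \<subseteq> x ` U" using chart_cball[OF ch open_UNIV] by auto
  obtain b :: "'e \<Rightarrow> real" where b: "smooth_on UNIV b" "\<And>z. z \<in> ball (x p) (R / 2) \<Longrightarrow> b z = 1"
    "\<And>z. z \<notin> cball (x p) R \<Longrightarrow> b z = 0"
    by (rule smooth_cutoff_exists[of "R / 2" R "x p"]) (use R in auto)
  define dr where "dr f q i = frechet_derivative (\<lambda>z. f (inv_into U x z)) (at (x q)) i" for f :: "'m \<Rightarrow> real" and q and i :: 'e
  define E where "E i q f = (if f \<in> CM \<and> q \<in> U then b (x q) * dr f q i else 0)" for i q f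
  define y where "y i q = (if q \<in> U then b (x q) * (x q \<bullet> i) else 0)" for i q
  define N where "N = {q \<in> U. x q \<in> ball (x p) (R / 2)}"
  note cut = CM_cutoff[OF ch(1) c(2) subset_refl _ b(1) compact_cball R(2) b(3)]
  have yC: "y i \<in> CM" for i
    unfolding y_def
    by (rule cut) (intro smooth_on_linear[OF c(2) bounded_linear_inner_left] smooth_on_ident c(2))
  have D: "((\<lambda>z. f (inv_into U x z)) has_derivative dr f q) (at (x q))" if "f \<in> CM" "q \<in> U" for f q
    unfolding dr_def using smooth_on_has_derivative[OF CM_D[OF that(1) ch(1)]] that by blast
  have drI: "dr f q i = d i" if "((\<lambda>z. f (inv_into U x z)) has_derivative d) (at (x q))" for f q d i
    unfolding dr_def using frechet_derivative_at[OF that] by simp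
  have ET: "E i q \<in> TM q" for i q
  proof (rule TM_I)
    fix f h assume f: "f \<in> CM" and h: "h \<in> CM"
    have "dr (\<lambda>q. f q + h q) q i = dr f q i + dr h q i" if "q \<in> U"
      using drI[of "\<lambda>q. f q + h q", OF has_derivative_add[OF D[OF f that] D[OF h that]]] .
    then show "E i q (\<lambda>q. f q + h q) = E i q f + E i q h"
      using f h CM_add[OF f h] by (simp add: E_def distrib_left)
    have "dr (\<lambda>q. f q * h q) q i = dr f q i * h q + f q * dr h q i" if "q \<in> U"
      using drI[of "\<lambda>q. f q * h q", OF has_derivative_mult[OF D[OF f that] D[OF h that]]]
      by (simp add: c(5)[OF that])
    then show "E i q (\<lambda>q. f q * h q) = E i q f * h q + f q * E i q h"
      using f h CM_mult[OF f h] by (simp add: E_def distrib_left)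
  next
    fix r f assume f: "f \<in> CM"
    have "dr (\<lambda>q. r * f q) q i = r * dr f q i" if "q \<in> U"
      using drI[of "\<lambda>q. r * f q", OF has_derivative_mult_right[OF D[OF f that]]] .
    then show "E i q (\<lambda>q. r * f q) = r * E i q f"
      using f CM_cmult[OF f] by (simp add: E_def)
  qed (simp add: E_def)
  have EX: "E i \<in> XM" if i: "i \<in> Basis" for i
    unfolding vector_fields_def
  proof (intro CollectI conjI allI ballI ET)
    fix f assume f: "f \<in> CM"
    have "(\<lambda>q. if q \<in> U then b (x q) * frechet_derivative (\<lambda>z. f (inv_into U x z)) (at (x q)) i else 0) \<in> CM"
      by (rule cut) (rule smooth_on_partial[OF CM_D[OF f ch(1)] i])
    moreover have "E i p f = (if p \<in> U then b (x p) *
        frechet_derivative (\<lambda>z. f (inv_into U x z)) (at (x p)) i else 0)" for p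
      using f by (simp add: E_def dr_def)
    ultimately show "(\<lambda>p. E i p f) \<in> CM" by presburger
  qed
  have yE: "E i q (y j) = (if i = j then 1 else 0)" if q: "q \<in> N" and i: "i \<in> Basis" and j: "j \<in> Basis" for q i j
  proof -
    have "((\<lambda>z. z \<bullet> j) has_derivative (\<lambda>h. h \<bullet> j)) (at (x q))"
      by (auto intro!: derivative_eq_intros)
    then have "((\<lambda>z. y j (inv_into U x z)) has_derivative (\<lambda>h. h \<bullet> j)) (at (x q))"
    proof (rule has_derivative_transform_within_open[OF _ open_ball])
      show "x q \<in> ball (x p) (R / 2)" using q by (simp add: N_def)
      fix z assume z: "z \<in> ball (x p) (R / 2)"
      then have "z \<in> x ` U" using R by auto
      then show "z \<bullet> j = y j (inv_into U x z)" using z b(2) c(6,7) by (simp add: y_def)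
    qed
    from drI[OF this] show ?thesis
      using q b(2) yC i j by (simp add: E_def N_def inner_Basis)
  qed
  have exp: "v = (\<Sum>i\<in>Basis. v (y i) *\<^sub>R E i q)" if q: "q \<in> N" and v: "v \<in> TM q" for q v
  proof
    fix f
    show "v f = (\<Sum>i\<in>Basis. v (y i) *\<^sub>R E i q) f"
    proof (cases "f \<in> CM")
      case False
      then show ?thesis by (simp add: sum_fun_apply E_def tangent_off[OF v])
    next
      case f: True
      have qU: "q \<in> U" and qb: "x q \<in> ball (x p) (R / 2)" using q by (auto simp: N_def)
      obtain s where s: "s > 0" "ball (x q) s \<subseteq> ball (x p) (R / 2)"
        using qb open_contains_ball[of "ball (x p) (R / 2)"] open_ball by blast
      have "ball (x p) (R / 2) \<subseteq> cball (x p) R" using R(1) by auto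
      then have sU: "ball (x q) s \<subseteq> x ` U" using s(2) R(2) by (meson order_trans)
      obtain h where h: "\<And>i. i \<in> Basis \<Longrightarrow> smooth_on (ball (x q) s) (h i)"
        "\<And>i. i \<in> Basis \<Longrightarrow> h i (x q) = dr f q i"
        "\<And>z. z \<in> ball (x q) s \<Longrightarrow> f (inv_into U x z) =
          f (inv_into U x (x q)) + (\<Sum>i\<in>Basis. ((z \<bullet> i) - (x q \<bullet> i)) * h i z)"
        using hadamard[OF smooth_on_subset[OF CM_D[OF f ch(1)] sU] s(1)] unfolding dr_def by blast
      obtain b2 :: "'e \<Rightarrow> real" where b2: "smooth_on UNIV b2" "\<And>z. z \<in> ball (x q) (s / 3) \<Longrightarrow> b2 z = 1"
        "\<And>z. z \<notin> cball (x q) (s / 2) \<Longrightarrow> b2 z = 0"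
        by (rule smooth_cutoff_exists[of "s / 3" "s / 2" "x q"]) (use s in auto)
      define H where "H i q = (if q \<in> U then b2 (x q) * h i (x q) else 0)" for i q
      have HC: "H i \<in> CM" if "i \<in> Basis" for i
        unfolding H_def
        by (rule CM_cutoff[OF ch(1) open_ball sU h(1)[OF that] b2(1)
              compact_cball[of "x q" "s / 2"] _ b2(3)]) (use s in auto)
      have Hq: "H i q = dr f q i" if "i \<in> Basis" for i
        using that qU s b2(2) h(2) by (simp add: H_def)
      have tC: "(\<lambda>r. (y i r - y i q) * H i r) \<in> CM" if "i \<in> Basis" for i
        by (intro CM_mult CM_diff yC CM_const HC that)
      have "v f = v (\<lambda>r. f q + (\<Sum>i\<in>Basis. (y i r - y i q) * H i r))"
      proof (rule tangent_local[OF v f])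
        show "(\<lambda>r. f q + (\<Sum>i\<in>Basis. (y i r - y i q) * H i r)) \<in> CM"
          by (intro CM_add CM_const CM_sum tC)
        show "open {r \<in> U. x r \<in> ball (x q) (s / 3)}" by (rule chart_preimage_open[OF ch(1) open_ball])
        show "q \<in> {r \<in> U. x r \<in> ball (x q) (s / 3)}" using qU s by simp
        fix r assume "r \<in> {r \<in> U. x r \<in> ball (x q) (s / 3)}"
        then have r: "r \<in> U" "x r \<in> ball (x q) (s / 3)" "x r \<in> ball (x q) s" using s by auto
        then have "b (x r) = 1" "b (x q) = 1" using b(2) s(2) qb by blast+
        then show "f r = f q + (\<Sum>i\<in>Basis. (y i r - y i q) * H i r)"
          using h(3)[OF r(3)] c(5) r qU b2(2)[OF r(2)] by (simp add: y_def H_def)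
      qed
      also have "\<dots> = (\<Sum>i\<in>Basis. v (y i) * H i q)"
      proof -
        have "v (\<lambda>r. (y i r - y i q) * H i r) = v (y i) * H i q" if i: "i \<in> Basis" for i
          using tangent_mult[OF v CM_diff[OF yC CM_const] HC[OF i], of i "y i q"]
          by (simp add: tangent_diff[OF v yC CM_const] tangent_const[OF v])
        then show ?thesis
          by (simp add: tangent_add[OF v CM_const CM_sum] tC tangent_sum[OF v] tangent_const[OF v])
      qed
      also have "\<dots> = (\<Sum>i\<in>Basis. v (y i) *\<^sub>R E i q) f"
        using Hq qU qb b(2) f by (simp add: sum_fun_apply E_def)
      finally show ?thesis .
    qed
  qed
  have "open N" unfolding N_def by (rule chart_preimage_open[OF ch(1) open_ball])
  moreover have "p \<in> N" using R ch by (simp add: N_def)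
  ultimately show thesis using that[of E y N] EX yC yE exp unfolding coord_frame_def by blast
qed

lemma coord_frameD:
  assumes "coord_frame E y N"
  shows "open N" "i \<in> Basis \<Longrightarrow> E i \<in> XM" "i \<in> Basis \<Longrightarrow> y i \<in> CM"
    "q \<in> N \<Longrightarrow> i \<in> Basis \<Longrightarrow> j \<in> Basis \<Longrightarrow> E i q (y j) = (if i = j then 1 else 0)"
    "q \<in> N \<Longrightarrow> v \<in> TM q \<Longrightarrow> v = (\<Sum>i\<in>Basis. v (y i) *\<^sub>R E i q)"
  using assms unfolding coord_frame_def by blast+

section \<open>Vector fields\<close>

lemma fmult_apply [simp]: "fmult f X p = f p *\<^sub>R X p"
  by (simp add: fmult_def)

lemma XM_I: "(\<And>p. X p \<in> TM p) \<Longrightarrow> (\<And>f. f \<in> CM \<Longrightarrow> (\<lambda>p. X p f) \<in> CM) \<Longrightarrow> X \<in> XM"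
  by (simp add: vector_fields_def)

lemma XM_at: "X \<in> XM \<Longrightarrow> X p \<in> TM p"
  by (simp add: vector_fields_def)

lemma XM_CM: "X \<in> XM \<Longrightarrow> f \<in> CM \<Longrightarrow> (\<lambda>p. X p f) \<in> CM"
  by (simp add: vector_fields_def)

lemma XM_zero: "0 \<in> XM"
  by (rule XM_I) (simp_all add: TM_zero CM_const)

lemma XM_add: "X \<in> XM \<Longrightarrow> Y \<in> XM \<Longrightarrow> X + Y \<in> XM"
  by (rule XM_I) (simp_all add: TM_add XM_at CM_add XM_CM)

lemma XM_diff: "X \<in> XM \<Longrightarrow> Y \<in> XM \<Longrightarrow> X - Y \<in> XM"
  by (rule XM_I) (simp_all add: TM_diff XM_at CM_diff XM_CM)

lemma XM_uminus: "X \<in> XM \<Longrightarrow> - X \<in> XM"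
  using XM_diff[OF XM_zero, of X] by simp

lemma XM_fmult: "f \<in> CM \<Longrightarrow> X \<in> XM \<Longrightarrow> fmult f X \<in> XM"
  by (rule XM_I) (simp_all add: TM_scaleR XM_at CM_mult XM_CM)

lemma XM_sum: "(\<And>j. j \<in> J \<Longrightarrow> X j \<in> XM) \<Longrightarrow> (\<Sum>j\<in>J. X j) \<in> XM"
  by (induction J rule: infinite_finite_induct) (auto intro: XM_zero XM_add)

lemma XM_ext: "X \<in> XM \<Longrightarrow> Y \<in> XM \<Longrightarrow> (\<And>p f. f \<in> CM \<Longrightarrow> X p f = Y p f) \<Longrightarrow> X = Y"
  by (intro ext) (metis XM_at tangent_off)

lemma vector_field_through:
  assumes "v \<in> TM p"
  obtains X where "X \<in> XM" "X p = v"
proof -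
  obtain E y N where F: "coord_frame E y N" "p \<in> N" using coord_frame_exists .
  let ?X = "\<Sum>i\<in>Basis. fmult (\<lambda>_. v (y i)) (E i)"
  have "?X p = v"
    using coord_frameD(5)[OF F(1) F(2) assms] by (simp add: sum_fun_apply)
  moreover have "?X \<in> XM" by (intro XM_sum XM_fmult CM_const coord_frameD(2)[OF F(1)])
  ultimately show thesis using that by blast
qed

abbreviation lb :: "'m vfield \<Rightarrow> 'm vfield \<Rightarrow> 'm vfield" where "lb \<equiv> lie_bracket A"

lemma lb_apply: "f \<in> CM \<Longrightarrow> lb X Y p f = X p (\<lambda>q. Y q f) - Y p (\<lambda>q. X q f)"
  by (simp add: lie_bracket_def)

lemma XM_lb:
  assumes X: "X \<in> XM" and Y: "Y \<in> XM"
  shows "lb X Y \<in> XM"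
proof (rule XM_I)
  note s = XM_CM[OF X] XM_CM[OF Y]
  fix p
  note t = XM_at[OF X, of p] XM_at[OF Y, of p]
  show "lb X Y p \<in> TM p"
  proof (rule TM_I)
    fix f h assume f: "f \<in> CM" and h: "h \<in> CM"
    have a: "X q (\<lambda>q. f q + h q) = X q f + X q h" "Y q (\<lambda>q. f q + h q) = Y q f + Y q h" for q
      using tangent_add[OF XM_at[OF X] f h] tangent_add[OF XM_at[OF Y] f h] by auto
    show "lb X Y p (\<lambda>q. f q + h q) = lb X Y p f + lb X Y p h"
      by (simp add: lb_apply f h CM_add a tangent_add[OF t(1)] tangent_add[OF t(2)] s)
    have b: "X q (\<lambda>q. f q * h q) = X q f * h q + f q * X q h"
      "Y q (\<lambda>q. f q * h q) = Y q f * h q + f q * Y q h" for q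
      using tangent_mult[OF XM_at[OF X] f h] tangent_mult[OF XM_at[OF Y] f h] by auto
    show "lb X Y p (\<lambda>q. f q * h q) = lb X Y p f * h p + f p * lb X Y p h"
      by (simp add: lb_apply f h CM_mult b tangent_add[OF t(1)] tangent_add[OF t(2)]
          tangent_mult[OF t(1)] tangent_mult[OF t(2)] s algebra_simps)
  next
    fix c f assume f: "f \<in> CM"
    have a: "X q (\<lambda>q. c * f q) = c * X q f" "Y q (\<lambda>q. c * f q) = c * Y q f" for q
      using tangent_cmult[OF XM_at[OF X] f] tangent_cmult[OF XM_at[OF Y] f] by auto
    show "lb X Y p (\<lambda>q. c * f q) = c * lb X Y p f"
      by (simp add: lb_apply f CM_cmult a tangent_cmult[OF t(1)] tangent_cmult[OF t(2)] s algebra_simps)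
  qed (simp add: lie_bracket_def)
next
  fix f assume f: "f \<in> CM"
  have "(\<lambda>p. X p (\<lambda>q. Y q f) - Y p (\<lambda>q. X q f)) \<in> CM"
    by (rule CM_diff[OF XM_CM[OF X XM_CM[OF Y f]] XM_CM[OF Y XM_CM[OF X f]]])
  then show "(\<lambda>p. lb X Y p f) \<in> CM" by (simp add: lb_apply f)
qed

lemma lb_swap: "X \<in> XM \<Longrightarrow> Y \<in> XM \<Longrightarrow> lb X Y = - lb Y X"
  by (rule XM_ext) (simp_all add: XM_lb XM_uminus lb_apply)

lemma lb_add_right:
  assumes "X \<in> XM" "Y \<in> XM" "Z \<in> XM"
  shows "lb X (Y + Z) = lb X Y + lb X Z"
  by (rule XM_ext)
     (simp_all add: assms XM_lb XM_add lb_apply tangent_add[OF XM_at[OF assms(1)]] XM_CM)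

lemma lb_diff_right:
  assumes "X \<in> XM" "Y \<in> XM" "Z \<in> XM"
  shows "lb X (Y - Z) = lb X Y - lb X Z"
  by (rule XM_ext)
     (simp_all add: assms XM_lb XM_diff lb_apply tangent_diff[OF XM_at[OF assms(1)]] XM_CM)

lemma lb_fmult_right:
  assumes "X \<in> XM" "Y \<in> XM" "f \<in> CM"
  shows "lb X (fmult f Y) = fmult f (lb X Y) + fmult (\<lambda>p. X p f) Y"
  by (rule XM_ext)
     (simp_all add: assms XM_lb XM_add XM_fmult lb_apply tangent_mult[OF XM_at[OF assms(1)]] XM_CM
       algebra_simps)

lemma lb_fmult_left:
  assumes "X \<in> XM" "Y \<in> XM" "f \<in> CM"
  shows "lb (fmult f X) Y = fmult f (lb X Y) - fmult (\<lambda>p. Y p f) X"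
  by (rule XM_ext)
     (simp_all add: assms XM_lb XM_diff XM_fmult lb_apply tangent_mult[OF XM_at[OF assms(2)]] XM_CM
       algebra_simps)

lemma lb_add_left:
  assumes "X \<in> XM" "Y \<in> XM" "Z \<in> XM"
  shows "lb (X + Y) Z = lb X Z + lb Y Z"
  by (rule XM_ext)
     (simp_all add: assms XM_lb XM_add lb_apply tangent_add[OF XM_at[OF assms(3)]] XM_CM)

lemma lb_jacobi:
  assumes "X \<in> XM" "Y \<in> XM" "Z \<in> XM"
  shows "lb X (lb Y Z) = lb (lb X Y) Z + lb Y (lb X Z)"
  by (rule XM_ext)
     (simp_all add: assms XM_lb XM_add lb_apply tangent_diff[OF XM_at[OF assms(1)]]
       tangent_diff[OF XM_at[OF assms(2)]] tangent_diff[OF XM_at[OF assms(3)]] XM_CM)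

section \<open>Traces of tensorial operators\<close>

text \<open>Linearity over the smooth functions, at one point: this is what makes the value depend on the
  vector field only through its value at the point.\<close>

definition tensorial_at :: "'m \<Rightarrow> ('m vfield \<Rightarrow> 'b::real_vector) \<Rightarrow> bool" where
  "tensorial_at p F \<longleftrightarrow> (\<forall>X\<in>XM. \<forall>Y\<in>XM. F (X + Y) = F X + F Y) \<and>
     (\<forall>f\<in>CM. \<forall>X\<in>XM. F (fmult f X) = f p *\<^sub>R F X)"

lemma tensorial_atI:
  "(\<And>X Y. X \<in> XM \<Longrightarrow> Y \<in> XM \<Longrightarrow> F (X + Y) = F X + F Y) \<Longrightarrow>
   (\<And>f X. f \<in> CM \<Longrightarrow> X \<in> XM \<Longrightarrow> F (fmult f X) = f p *\<^sub>R F X) \<Longrightarrow> tensorial_at p F"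
  by (simp add: tensorial_at_def)

lemma tensorial_at_add: "tensorial_at p F \<Longrightarrow> X \<in> XM \<Longrightarrow> Y \<in> XM \<Longrightarrow> F (X + Y) = F X + F Y"
  by (simp add: tensorial_at_def)

lemma tensorial_at_fmult: "tensorial_at p F \<Longrightarrow> f \<in> CM \<Longrightarrow> X \<in> XM \<Longrightarrow> F (fmult f X) = f p *\<^sub>R F X"
  by (simp add: tensorial_at_def)

lemma tensorial_at_plus:
  assumes F: "tensorial_at p F" and H: "tensorial_at p H"
  shows "tensorial_at p (\<lambda>X. F X + H X)"
  by (rule tensorial_atI)
     (simp_all only: tensorial_at_add[OF F] tensorial_at_add[OF H]
       tensorial_at_fmult[OF F] tensorial_at_fmult[OF H] scaleR_add_right add_ac)

lemma tensorial_at_zero: "tensorial_at p F \<Longrightarrow> F 0 = 0"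
  using tensorial_at_add[of p F 0 0] XM_zero by simp

lemma tensorial_at_sum:
  assumes "tensorial_at p F" "\<And>j. j \<in> J \<Longrightarrow> X j \<in> XM"
  shows "F (\<Sum>j\<in>J. X j) = (\<Sum>j\<in>J. F (X j))"
  using assms(2)
  by (induction J rule: infinite_finite_induct)
     (auto simp: tensorial_at_zero[OF assms(1)] tensorial_at_add[OF assms(1)] XM_sum)

text \<open>The expansion of a vector field in the frame is only local, but after multiplication by a bump
  function it becomes an identity between global vector fields, to which \<^term>\<open>F\<close> can be applied.\<close>

lemma tensorial_at_expand:
  assumes F: "tensorial_at p F" and fr: "coord_frame E y N" "p \<in> N" and X: "X \<in> XM"
  shows "F X = (\<Sum>i\<in>Basis. X p (y i) *\<^sub>R F (E i))"
proof -
  note fD = coord_frameD[OF fr(1)]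
  obtain \<psi> where psi: "\<psi> \<in> CM" "\<psi> p = 1" "\<And>q. q \<notin> N \<Longrightarrow> \<psi> q = 0"
    using bump_exists[OF fD(1) fr(2)] by metis
  have c: "(\<lambda>q. \<psi> q * X q (y i)) \<in> CM" if "i \<in> Basis" for i
    by (rule CM_mult[OF psi(1) XM_CM[OF X fD(3)[OF that]]])
  have "fmult \<psi> X = (\<Sum>i\<in>Basis. fmult (\<lambda>q. \<psi> q * X q (y i)) (E i))"
  proof
    fix q
    show "fmult \<psi> X q = (\<Sum>i\<in>Basis. fmult (\<lambda>q. \<psi> q * X q (y i)) (E i)) q"
    proof (cases "q \<in> N")
      case True
      have "fmult \<psi> X q = \<psi> q *\<^sub>R (\<Sum>i\<in>Basis. X q (y i) *\<^sub>R E i q)"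
        using fD(5)[OF True XM_at[OF X]] by simp
      then show ?thesis by (simp add: sum_fun_apply scaleR_sum_right)
    qed (simp add: psi sum_fun_apply)
  qed
  then have "F (fmult \<psi> X) = (\<Sum>i\<in>Basis. F (fmult (\<lambda>q. \<psi> q * X q (y i)) (E i)))"
    by (simp add: tensorial_at_sum[OF F] XM_fmult c fD)
  then show ?thesis by (simp add: tensorial_at_fmult[OF F] psi X c fD)
qed

lemma tensorial_at_cong:
  assumes "tensorial_at p F" "X \<in> XM" "Y \<in> XM" "X p = Y p"
  shows "F X = F Y"
proof -
  obtain E y N where "coord_frame E y N" "p \<in> N" using coord_frame_exists .
  then show ?thesis using assms by (simp add: tensorial_at_expand)
qed

text \<open>The trace does not depend on the basis: expanding the picked basis \<open>B\<close> in the frame turns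
  the sum over \<open>B\<close> into the sum over the frame.\<close>

lemma trace_on_frame:
  assumes fr: "coord_frame E y N" "p \<in> N"
    and T: "linear_on_subspace (TM p) T" "\<And>v. v \<in> TM p \<Longrightarrow> T v \<in> TM p"
  shows "trace_on (TM p) T = (\<Sum>i\<in>Basis. T (E i p) (y i))"
proof -
  note fD = coord_frameD[OF fr(1)]
  define B where "B = (SOME B. independent B \<and> B \<subseteq> TM p \<and> span B = TM p)"
  have "\<exists>B. independent B \<and> B \<subseteq> TM p \<and> span B = TM p"
    using maximal_independent_subset[of "TM p"] span_subspace[OF _ _ TM_subspace] by metis
  then have B: "independent B" "B \<subseteq> TM p" "span B = TM p"
    unfolding B_def by (metis (mono_tags, lifting) someI_ex)+
  have "TM p \<subseteq> span ((\<lambda>i. E i p) ` Basis)"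
  proof
    fix v assume "v \<in> TM p"
    then have "v = (\<Sum>i\<in>Basis. v (y i) *\<^sub>R E i p)" by (rule fD(5)[OF fr(2)])
    also have "\<dots> \<in> span ((\<lambda>i. E i p) ` Basis)" by (intro span_sum span_scale span_base imageI)
    finally show "v \<in> span ((\<lambda>i. E i p) ` Basis)" .
  qed
  then have fin: "finite B"
    using independent_span_bound[of "(\<lambda>i. E i p) ` Basis" B] B by auto
  have Esp: "E i p \<in> TM p" if "i \<in> Basis" for i by (rule XM_at[OF fD(2)[OF that]])
  have Ts: "T (\<Sum>i\<in>J. c i *\<^sub>R E i p) = (\<Sum>i\<in>J. c i *\<^sub>R T (E i p))" if "J \<subseteq> Basis" for c J
    using finite_subset[OF that finite_Basis] that
  proof (induction J rule: finite_induct)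
    case empty
    have "T (0 *\<^sub>R 0) = 0 *\<^sub>R T 0" using T(1) TM_zero unfolding linear_on_subspace_def by blast
    then show ?case by (simp only: scaleR_zero_left sum.empty)
  next
    case (insert i J)
    have "T (c i *\<^sub>R E i p + (\<Sum>i\<in>J. c i *\<^sub>R E i p)) = c i *\<^sub>R T (E i p) + T (\<Sum>i\<in>J. c i *\<^sub>R E i p)"
      using T(1) insert.prems Esp TM_sum[of J "\<lambda>i. c i *\<^sub>R E i p" p] TM_scaleR[of _ p]
      unfolding linear_on_subspace_def by (auto simp: subset_iff)
    moreover have "J \<subseteq> Basis" using insert.prems by simp
    ultimately show ?case by (simp only: sum.insert[OF insert.hyps] insert.IH)
  qed
  have repT: "representation B (T b) b = (\<Sum>i\<in>Basis. b (y i) * representation B (T (E i p)) b)"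
    if b: "b \<in> B" for b
  proof -
    have "T b = (\<Sum>i\<in>Basis. b (y i) *\<^sub>R T (E i p))"
      using Ts[of Basis "\<lambda>i. b (y i)"] fD(5)[OF fr(2), of b] B(2) b by auto
    moreover have "T (E i p) \<in> span B" if "i \<in> Basis" for i using B(3) T(2)[OF Esp[OF that]] by simp
    ultimately show ?thesis
      using representation_sum[OF B(1), of Basis "\<lambda>i. b (y i) *\<^sub>R T (E i p)"]
      by (simp add: representation_scale[OF B(1)] span_scale)
  qed
  have "trace_on (TM p) T = (\<Sum>b\<in>B. representation B (T b) b)"
    by (simp add: trace_on_def B_def Let_def)
  also have "\<dots> = (\<Sum>b\<in>B. \<Sum>i\<in>Basis. b (y i) * representation B (T (E i p)) b)"
    by (rule sum.cong) (simp_all add: repT)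
  also have "\<dots> = (\<Sum>i\<in>Basis. \<Sum>b\<in>B. b (y i) * representation B (T (E i p)) b)"
    by (rule sum.swap)
  also have "\<dots> = (\<Sum>i\<in>Basis. T (E i p) (y i))"
  proof (rule sum.cong[OF refl])
    fix i :: 'e assume i: "i \<in> Basis"
    have "(\<Sum>b\<in>B. representation B (T (E i p)) b *\<^sub>R b) = T (E i p)"
      by (rule sum_representation_eq) (use B fin T(2)[OF Esp[OF i]] in auto)
    from arg_cong[OF this, of "\<lambda>v. v (y i)"]
    show "(\<Sum>b\<in>B. b (y i) * representation B (T (E i p)) b) = T (E i p) (y i)"
      by (simp add: sum_fun_apply mult.commute)
  qed
  finally show ?thesis .
qed

text \<open>The trace at \<open>p\<close> of an operator on vector fields that is tensorial at \<open>p\<close>.  The extension of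
  tangent vectors is picked as in the definition of the Ricci tensor, so that the latter is an instance
  by definition.\<close>

definition tr :: "'m \<Rightarrow> ('m vfield \<Rightarrow> 'm tangent) \<Rightarrow> real" where
  "tr p F = trace_on (TM p) (\<lambda>v. F (SOME X. X \<in> XM \<and> X p = v))"

lemma tr_frame:
  assumes fr: "coord_frame E y N" "p \<in> N"
    and F: "tensorial_at p F" "\<And>X. X \<in> XM \<Longrightarrow> F X \<in> TM p"
  shows "tr p F = (\<Sum>i\<in>Basis. F (E i) (y i))"
proof -
  define ex where "ex v = (SOME X. X \<in> XM \<and> X p = v)" for v
  have "ex v \<in> XM \<and> ex v p = v" if "v \<in> TM p" for v
  proof -
    have "\<exists>X. X \<in> XM \<and> X p = v" using vector_field_through[OF that] by blast
    then show ?thesis unfolding ex_def by (rule someI_ex)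
  qed
  then have ex: "ex v \<in> XM" "ex v p = v" if "v \<in> TM p" for v using that by blast+
  have "linear_on_subspace (TM p) (\<lambda>v. F (ex v))"
    unfolding linear_on_subspace_def
  proof (intro conjI ballI allI)
    fix u v assume u: "u \<in> TM p" and v: "v \<in> TM p"
    have "F (ex (u + v)) = F (ex u + ex v)"
      by (rule tensorial_at_cong[OF F(1)]) (use u v in \<open>simp_all add: ex XM_add TM_add\<close>)
    then show "F (ex (u + v)) = F (ex u) + F (ex v)"
      using tensorial_at_add[OF F(1) ex(1)[OF u] ex(1)[OF v]] by (simp only:)
  next
    fix c u assume u: "u \<in> TM p"
    have "F (ex (c *\<^sub>R u)) = F (fmult (\<lambda>_. c) (ex u))"
      by (rule tensorial_at_cong[OF F(1)]) (use u in \<open>simp_all add: ex XM_fmult TM_scaleR CM_const\<close>)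
    then show "F (ex (c *\<^sub>R u)) = c *\<^sub>R F (ex u)"
      using tensorial_at_fmult[OF F(1) CM_const ex(1)[OF u]] by (simp only:)
  qed
  from trace_on_frame[OF fr this] have "tr p F = (\<Sum>i\<in>Basis. F (ex (E i p)) (y i))"
    using F(2) ex by (simp add: tr_def ex_def)
  also have "\<dots> = (\<Sum>i\<in>Basis. F (E i) (y i))"
  proof (rule sum.cong[OF refl])
    fix i :: 'e assume "i \<in> Basis"
    then have E: "E i \<in> XM" by (rule coord_frameD(2)[OF fr(1)])
    have "F (ex (E i p)) = F (E i)"
      by (rule tensorial_at_cong[OF F(1) ex(1)[OF XM_at[OF E]] E ex(2)[OF XM_at[OF E]]])
    then show "F (ex (E i p)) (y i) = F (E i) (y i)" by (simp only:)
  qed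
  finally show ?thesis .
qed

lemma tr_add:
  assumes "tensorial_at p F" "\<And>X. X \<in> XM \<Longrightarrow> F X \<in> TM p"
    and "tensorial_at p G" "\<And>X. X \<in> XM \<Longrightarrow> G X \<in> TM p"
  shows "tr p (\<lambda>X. F X + G X) = tr p F + tr p G"
proof -
  obtain E y N where fr: "coord_frame E y N" "p \<in> N" using coord_frame_exists .
  from tr_frame[OF fr tensorial_at_plus[OF assms(1,3)]] show ?thesis
    by (simp add: tr_frame[OF fr assms(1,2)] tr_frame[OF fr assms(3,4)] TM_add assms sum.distrib)
qed

lemma tr_cong_on_XM:
  assumes "tensorial_at p F" "\<And>X. X \<in> XM \<Longrightarrow> F X \<in> TM p" "\<And>X. X \<in> XM \<Longrightarrow> G X = F X"
  shows "tr p G = tr p F"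
proof -
  obtain E y N where fr: "coord_frame E y N" "p \<in> N" using coord_frame_exists .
  have t: "tensorial_at p G"
    by (rule tensorial_atI)
       (simp_all only: assms(3) XM_add XM_fmult tensorial_at_add[OF assms(1)] tensorial_at_fmult[OF assms(1)])
  have m: "G X \<in> TM p" if "X \<in> XM" for X using assms that by simp
  show ?thesis
    using tr_frame[OF fr t m] tr_frame[OF fr assms(1,2)]
    by (simp add: assms(3) coord_frameD(2)[OF fr(1)])
qed

lemma tensorial_at_eval: "tensorial_at p (\<lambda>X. X p)"
  by (rule tensorial_atI) simp_all

lemma tr_scalar_plus_rank_one:
  assumes \<omega>: "tensorial_at p (\<omega> :: 'm vfield \<Rightarrow> real)" and U: "U \<in> XM"
    and F: "\<And>X. X \<in> XM \<Longrightarrow> F X = c *\<^sub>R X p + \<omega> X *\<^sub>R U p"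
  shows "tr p F = c * DIM('e) + \<omega> U"
proof -
  obtain E y N where fr: "coord_frame E y N" "p \<in> N" using coord_frame_exists .
  note fD = coord_frameD[OF fr(1)]
  have t: "tensorial_at p F"
    by (rule tensorial_atI)
       (simp_all only: F XM_add XM_fmult tensorial_at_add[OF \<omega>] tensorial_at_fmult[OF \<omega>]
         tensorial_at_add[OF tensorial_at_eval] tensorial_at_fmult[OF tensorial_at_eval]
         scaleR_add_right scaleR_add_left scaleR_scaleR real_scaleR_def mult_ac add_ac)
  have m: "F X \<in> TM p" if "X \<in> XM" for X
    using that by (simp only: F TM_add TM_scaleR XM_at U)
  have "tr p F = (\<Sum>i\<in>Basis. c * E i p (y i) + \<omega> (E i) * U p (y i))"
    using tr_frame[OF fr t m] by (simp add: F fD(2))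
  also have "\<dots> = (\<Sum>i\<in>(Basis::'e set). c) + (\<Sum>i\<in>Basis. U p (y i) *\<^sub>R \<omega> (E i))"
    by (simp add: sum.distrib fD(4)[OF fr(2)] mult.commute)
  also have "(\<Sum>i\<in>Basis. U p (y i) *\<^sub>R \<omega> (E i)) = \<omega> U"
    by (rule tensorial_at_expand[OF \<omega> fr U, symmetric])
  finally show ?thesis by (simp add: mult.commute)
qed

text \<open>The trace commutes with the Lie derivative.  In a coordinate frame, where \<open>E\<^sub>i y\<^sub>k\<close> is locally
  constant, the derivatives of \<open>E\<^sub>i\<close> and of \<open>y\<^sub>i\<close> along \<open>V\<close> are given by the same coefficients
  \<open>E\<^sub>i(V y\<^sub>k)\<close> with opposite signs, and their contributions to the trace cancel.\<close>

lemma deriv_tr: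
  assumes V: "V \<in> XM" and F: "\<And>X. X \<in> XM \<Longrightarrow> F X \<in> XM" "\<And>q. tensorial_at q (\<lambda>X. F X q)"
    and sm: "(\<lambda>q. tr q (\<lambda>X. F X q)) \<in> CM"
  shows "V p (\<lambda>q. tr q (\<lambda>X. F X q)) = tr p (\<lambda>X. lb V (F X) p - F (lb V X) p)"
proof -
  obtain E y N where fr: "coord_frame E y N" "p \<in> N" using coord_frame_exists .
  note fD = coord_frameD[OF fr(1)]
  define z where "z i q = V q (y i)" for i q
  have zC: "z i \<in> CM" if "i \<in> Basis" for i
    using XM_CM[OF V fD(3)[OF that]] by (simp add: z_def[abs_def])
  have Fadd: "F (X + Y) = F X + F Y" if "X \<in> XM" "Y \<in> XM" for X Y
    by (rule ext) (simp only: tensorial_at_add[OF F(2) that] plus_fun_apply)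
  have Ff: "F (fmult f X) = fmult f (F X)" if "f \<in> CM" "X \<in> XM" for f X
    by (rule ext) (simp only: tensorial_at_fmult[OF F(2) that] fmult_apply)
  have t: "tensorial_at p (\<lambda>X. lb V (F X) p - F (lb V X) p)"
  proof (rule tensorial_atI)
    fix X Y assume XY: "X \<in> XM" "Y \<in> XM"
    show "lb V (F (X + Y)) p - F (lb V (X + Y)) p = lb V (F X) p - F (lb V X) p + (lb V (F Y) p - F (lb V Y) p)"
      by (simp only: Fadd XY lb_add_right V F(1) XM_lb plus_fun_apply) (simp only: algebra_simps)
  next
    fix f X assume f: "f \<in> CM" and X: "X \<in> XM"
    have Vf: "(\<lambda>p. V p f) \<in> CM" by (rule XM_CM[OF V f])
    show "lb V (F (fmult f X)) p - F (lb V (fmult f X)) p = f p *\<^sub>R (lb V (F X) p - F (lb V X) p)"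
      by (simp only: Fadd Ff f X lb_fmult_right V F(1) XM_lb XM_fmult Vf plus_fun_apply fmult_apply)
         (simp only: algebra_simps)
  qed
  have m: "lb V (F X) p - F (lb V X) p \<in> TM p" if "X \<in> XM" for X
    by (rule TM_diff) (auto intro: XM_at XM_lb V F that)
  have y1: "F (E i) p (z i) = (\<Sum>k\<in>Basis. F (E i) p (y k) * E k p (z i))" if "i \<in> Basis" for i
    using arg_cong[OF fD(5)[OF fr(2) XM_at[OF F(1)[OF fD(2)[OF that]]]], of "\<lambda>v. v (z i)"]
    by (simp add: sum_fun_apply)
  \<comment> \<open>\<open>E i (y k)\<close> is constant near \<open>p\<close>, which leaves one of the two terms of the bracket.\<close>
  have y2: "lb V (E i) p (y k) = - E i p (z k)" if i: "i \<in> Basis" and k: "k \<in> Basis" for i k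
  proof -
    have "V p (\<lambda>q. E i q (y k)) = V p (\<lambda>_. if i = k then 1 else 0)"
      by (rule tangent_local[OF XM_at[OF V] XM_CM[OF fD(2)[OF i] fD(3)[OF k]] CM_const fD(1) fr(2)])
         (rule fD(4)[OF _ i k])
    then show ?thesis
      by (simp add: lb_apply fD(3)[OF k] tangent_const[OF XM_at[OF V]] z_def[abs_def])
  qed
  have y3: "F (lb V (E i)) p (y i) = - (\<Sum>k\<in>Basis. E i p (z k) * F (E k) p (y i))" if i: "i \<in> Basis" for i
    using arg_cong[OF tensorial_at_expand[OF F(2) fr XM_lb[OF V fD(2)[OF i]]], of "\<lambda>v. v (y i)"]
    by (simp add: sum_fun_apply y2 i sum_negf)
  have "V p (\<lambda>q. tr q (\<lambda>X. F X q)) = V p (\<lambda>q. \<Sum>i\<in>Basis. F (E i) q (y i))"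
  proof (rule tangent_local[OF XM_at[OF V] sm _ fD(1) fr(2)])
    show "(\<lambda>q. \<Sum>i\<in>Basis. F (E i) q (y i)) \<in> CM"
      by (rule CM_sum) (rule XM_CM[OF F(1)[OF fD(2)] fD(3)])
    show "tr q (\<lambda>X. F X q) = (\<Sum>i\<in>Basis. F (E i) q (y i))" if "q \<in> N" for q
      by (rule tr_frame[OF fr(1) that F(2)]) (rule XM_at[OF F(1)])
  qed
  also have "\<dots> = (\<Sum>i\<in>Basis. V p (\<lambda>q. F (E i) q (y i)))"
    by (rule tangent_sum[OF XM_at[OF V]]) (rule XM_CM[OF F(1)[OF fD(2)] fD(3)])
  also have "\<dots> = (\<Sum>i\<in>Basis. lb V (F (E i)) p (y i) + F (E i) p (z i))"
    by (rule sum.cong) (simp_all add: lb_apply fD(3) z_def[abs_def])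
  also have "\<dots> = (\<Sum>i\<in>Basis. lb V (F (E i)) p (y i)) + (\<Sum>i\<in>Basis. \<Sum>k\<in>Basis. F (E i) p (y k) * E k p (z i))"
    by (simp add: sum.distrib y1)
  also have "(\<Sum>i\<in>Basis. \<Sum>k\<in>Basis. F (E i) p (y k) * E k p (z i))
      = (\<Sum>k\<in>Basis. \<Sum>i\<in>Basis. F (E i) p (y k) * E k p (z i))"
    by (rule sum.swap)
  also have "\<dots> = (\<Sum>i\<in>Basis. - F (lb V (E i)) p (y i))"
    by (rule sum.cong) (simp_all add: y3 mult.commute)
  also have "(\<Sum>i\<in>Basis. lb V (F (E i)) p (y i)) + (\<Sum>i\<in>Basis. - F (lb V (E i)) p (y i))
      = (\<Sum>i\<in>Basis. (lb V (F (E i)) p - F (lb V (E i)) p) (y i))"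
    by (simp add: sum.distrib[symmetric])
  also have "\<dots> = tr p (\<lambda>X. lb V (F X) p - F (lb V X) p)"
    by (rule tr_frame[OF fr t m, symmetric])
  finally show ?thesis .
qed

end

section \<open>Levi-Civita connections\<close>

locale levi_civita = manifold A
  for A :: "('m::{t2_space,second_countable_topology}, 'e::euclidean_space) chart set" +
  fixes g :: "'m \<Rightarrow> 'm tangent \<Rightarrow> 'm tangent \<Rightarrow> real"
    and D :: "'m vfield \<Rightarrow> 'm vfield \<Rightarrow> 'm vfield"
  assumes metric: "pseudo_riemannian_metric A g"
    and lc: "levi_civita_connection A g D"
begin

lemma g_sym: "u \<in> TM p \<Longrightarrow> v \<in> TM p \<Longrightarrow> g p u v = g p v u"
  using metric unfolding pseudo_riemannian_metric_def by blast

lemma g_add_right: "u \<in> TM p \<Longrightarrow> v \<in> TM p \<Longrightarrow> w \<in> TM p \<Longrightarrow> g p u (v + w) = g p u v + g p u w"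
  using metric unfolding pseudo_riemannian_metric_def linear_on_subspace_def by blast

lemma g_scaleR_right: "u \<in> TM p \<Longrightarrow> v \<in> TM p \<Longrightarrow> g p u (c *\<^sub>R v) = c * g p u v"
  using metric unfolding pseudo_riemannian_metric_def linear_on_subspace_def real_scaleR_def by blast

lemma g_add_left: "u \<in> TM p \<Longrightarrow> v \<in> TM p \<Longrightarrow> w \<in> TM p \<Longrightarrow> g p (u + v) w = g p u w + g p v w"
  by (simp only: g_sym[of _ p w] TM_add g_add_right)

lemma g_scaleR_left: "u \<in> TM p \<Longrightarrow> v \<in> TM p \<Longrightarrow> g p (c *\<^sub>R u) v = c * g p u v"
  by (simp only: g_sym[of _ p v] TM_scaleR g_scaleR_right)

lemma g_diff_left:
  assumes "u \<in> TM p" "v \<in> TM p" "w \<in> TM p"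
  shows "g p (u - v) w = g p u w - g p v w"
  using g_add_left[OF TM_diff[OF assms(1,2)] assms(2,3)] by (simp only: diff_add_cancel eq_diff_eq)

lemma g_diff_right:
  "u \<in> TM p \<Longrightarrow> v \<in> TM p \<Longrightarrow> w \<in> TM p \<Longrightarrow> g p u (v - w) = g p u v - g p u w"
  by (simp only: g_sym[of u] TM_diff g_diff_left)

lemma g_nondegenerate:
  assumes "u \<in> TM p" "\<And>v. v \<in> TM p \<Longrightarrow> g p u v = 0"
  shows "u = 0"
proof -
  have "\<forall>u\<in>TM p. (\<forall>v\<in>TM p. g p u v = 0) \<longrightarrow> u = 0"
    using metric unfolding pseudo_riemannian_metric_def by (elim conjE allE[of _ p])
  from bspec[OF this assms(1)] show ?thesis by (rule mp) (intro ballI assms(2))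
qed

lemma g_smooth: "X \<in> XM \<Longrightarrow> Y \<in> XM \<Longrightarrow> (\<lambda>p. g p (X p) (Y p)) \<in> CM"
  by (rule bspec[OF bspec[OF conjunct2[OF metric[unfolded pseudo_riemannian_metric_def]]]])

lemma XM_D: "X \<in> XM \<Longrightarrow> Y \<in> XM \<Longrightarrow> D X Y \<in> XM"
  using lc unfolding levi_civita_connection_def affine_connection_def by blast

lemma D_add_left: "X \<in> XM \<Longrightarrow> Y \<in> XM \<Longrightarrow> Z \<in> XM \<Longrightarrow> D (X + Y) Z = D X Z + D Y Z"
  using lc unfolding levi_civita_connection_def affine_connection_def by blast

lemma D_add_right: "X \<in> XM \<Longrightarrow> Y \<in> XM \<Longrightarrow> Z \<in> XM \<Longrightarrow> D X (Y + Z) = D X Y + D X Z"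
  using lc unfolding levi_civita_connection_def affine_connection_def by blast

lemma D_fmult_left: "f \<in> CM \<Longrightarrow> X \<in> XM \<Longrightarrow> Y \<in> XM \<Longrightarrow> D (fmult f X) Y = fmult f (D X Y)"
  using lc unfolding levi_civita_connection_def affine_connection_def by blast

lemma D_fmult_right:
  "f \<in> CM \<Longrightarrow> X \<in> XM \<Longrightarrow> Y \<in> XM \<Longrightarrow> D X (fmult f Y) = fmult f (D X Y) + fmult (\<lambda>p. X p f) Y"
  using lc unfolding levi_civita_connection_def affine_connection_def by blast

lemma D_torsion: "X \<in> XM \<Longrightarrow> Y \<in> XM \<Longrightarrow> lb X Y = D X Y - D Y X"
  using lc unfolding levi_civita_connection_def by metis

lemma D_metric:
  "X \<in> XM \<Longrightarrow> Y \<in> XM \<Longrightarrow> Z \<in> XM \<Longrightarrow>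
    X p (\<lambda>q. g q (Y q) (Z q)) = g p (D X Y p) (Z p) + g p (Y p) (D X Z p)"
  using lc unfolding levi_civita_connection_def by blast

lemma D_diff_left:
  assumes "X \<in> XM" "Y \<in> XM" "Z \<in> XM"
  shows "D (X - Y) Z = D X Z - D Y Z"
  using D_add_left[OF XM_diff[OF assms(1,2)] assms(2,3)] by (simp only: diff_add_cancel eq_diff_eq)

lemma D_diff_right:
  assumes "X \<in> XM" "Y \<in> XM" "Z \<in> XM"
  shows "D X (Y - Z) = D X Y - D X Z"
  using D_add_right[OF assms(1) XM_diff[OF assms(2,3)] assms(3)] by (simp only: diff_add_cancel eq_diff_eq)

abbreviation R :: "'m vfield \<Rightarrow> 'm vfield \<Rightarrow> 'm vfield \<Rightarrow> 'm vfield" where "R \<equiv> curvature A D"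

lemma XM_R: "X \<in> XM \<Longrightarrow> Y \<in> XM \<Longrightarrow> Z \<in> XM \<Longrightarrow> R X Y Z \<in> XM"
  by (simp only: curvature_def XM_diff XM_D XM_lb)

lemma R_tensorial:
  assumes Y: "Y \<in> XM" and Z: "Z \<in> XM"
  shows "tensorial_at p (\<lambda>X. R X Y Z p)"
proof (rule tensorial_atI)
  fix X X' assume X: "X \<in> XM" "X' \<in> XM"
  show "R (X + X') Y Z p = R X Y Z p + R X' Y Z p"
    by (simp only: curvature_def X Y Z D_add_left D_add_right lb_add_left XM_D XM_lb XM_add
        plus_fun_apply minus_apply) (simp only: algebra_simps)
next
  fix f X assume f: "f \<in> CM" and X: "X \<in> XM"
  have Yf: "(\<lambda>p. Y p f) \<in> CM" by (rule XM_CM[OF Y f])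
  show "R (fmult f X) Y Z p = f p *\<^sub>R R X Y Z p"
    by (simp only: curvature_def f Yf X Y Z D_diff_left D_fmult_left D_fmult_right lb_fmult_left
        XM_D XM_lb XM_fmult plus_fun_apply minus_apply fmult_apply) (simp only: algebra_simps)
qed

lemma ricci_eq_tr: "ricci A D Y Z p = tr p (\<lambda>X. R X Y Z p)"
  by (simp only: ricci_def tr_def)

end

section \<open>Torse-forming fields of constant length\<close>

locale torse_forming_unit = levi_civita A g D
  for A :: "('m::{t2_space,second_countable_topology}, 'e::euclidean_space) chart set"
    and g :: "'m \<Rightarrow> 'm tangent \<Rightarrow> 'm tangent \<Rightarrow> real"
    and D :: "'m vfield \<Rightarrow> 'm vfield \<Rightarrow> 'm vfield" +
  fixes \<xi> :: "'m vfield" and \<eta> :: "'m \<Rightarrow> 'm tangent \<Rightarrow> real" and \<epsilon> :: real and f :: "'m \<Rightarrow> real"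
  assumes xi: "\<xi> \<in> XM" and eta: "one_form A \<eta>" and eps: "\<epsilon> * \<epsilon> = 1"
    and eta_xi: "\<eta> p (\<xi> p) = 1"
    and g_xi: "X \<in> XM \<Longrightarrow> g p (X p) (\<xi> p) = \<epsilon> * \<eta> p (X p)"
    and f: "f \<in> CM"
    and D_xi: "X \<in> XM \<Longrightarrow> D X \<xi> = fmult f (X - fmult (\<lambda>p. \<eta> p (X p)) \<xi>)"
begin

lemma eta_smooth: "X \<in> XM \<Longrightarrow> (\<lambda>p. \<eta> p (X p)) \<in> CM"
  by (rule bspec[OF conjunct2[OF eta[unfolded one_form_def]]])

lemma eta_add: "u \<in> TM p \<Longrightarrow> v \<in> TM p \<Longrightarrow> \<eta> p (u + v) = \<eta> p u + \<eta> p v"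
  using eta unfolding one_form_def linear_on_subspace_def by blast

lemma eta_scaleR: "u \<in> TM p \<Longrightarrow> \<eta> p (c *\<^sub>R u) = c * \<eta> p u"
  using eta unfolding one_form_def linear_on_subspace_def real_scaleR_def by blast

lemma eta_diff:
  assumes "u \<in> TM p" "v \<in> TM p"
  shows "\<eta> p (u - v) = \<eta> p u - \<eta> p v"
  using eta_add[OF TM_diff[OF assms] assms(2)] by (simp only: diff_add_cancel eq_diff_eq)

text \<open>The part of the metric that is transverse to \<open>\<xi>\<close>.\<close>

definition G :: "'m \<Rightarrow> 'm tangent \<Rightarrow> 'm tangent \<Rightarrow> real" where
  "G p u v = g p u v - \<epsilon> * (\<eta> p u * \<eta> p v)"

lemma G_smooth: "X \<in> XM \<Longrightarrow> Y \<in> XM \<Longrightarrow> (\<lambda>p. G p (X p) (Y p)) \<in> CM"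
  unfolding G_def by (rule CM_diff[OF g_smooth CM_cmult[OF CM_mult[OF eta_smooth eta_smooth]]])

lemma G_sym: "u \<in> TM p \<Longrightarrow> v \<in> TM p \<Longrightarrow> G p u v = G p v u"
  by (simp add: G_def g_sym[of u p v])

lemma G_add_left: "u \<in> TM p \<Longrightarrow> v \<in> TM p \<Longrightarrow> w \<in> TM p \<Longrightarrow> G p (u + v) w = G p u w + G p v w"
  by (simp only: G_def g_add_left eta_add) (simp only: algebra_simps)

lemma G_scaleR_left: "u \<in> TM p \<Longrightarrow> v \<in> TM p \<Longrightarrow> G p (c *\<^sub>R u) v = c * G p u v"
  by (simp only: G_def g_scaleR_left eta_scaleR) (simp only: algebra_simps)

lemma G_xi: "X \<in> XM \<Longrightarrow> G p (X p) (\<xi> p) = 0"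
  by (simp add: G_def g_xi eta_xi)

lemma D_xi_at: "X \<in> XM \<Longrightarrow> D X \<xi> p = f p *\<^sub>R (X p - \<eta> p (X p) *\<^sub>R \<xi> p)"
  by (simp only: D_xi fmult_apply minus_apply)

lemma g_D_xi:
  assumes "X \<in> XM" "Y \<in> XM"
  shows "g p (Y p) (D X \<xi> p) = f p * G p (X p) (Y p)"
proof -
  note t = XM_at[OF assms(1), of p] XM_at[OF assms(2), of p] XM_at[OF xi, of p]
  show ?thesis
    by (simp add: D_xi_at assms g_scaleR_right g_diff_right t TM_scaleR TM_diff g_xi G_def
        g_sym[OF t(2) t(1)] mult.commute)
qed

text \<open>The covariant derivative of \<^term>\<open>\<eta>\<close> is \<open>\<epsilon> f G\<close>.\<close>

lemma deriv_eta:
  assumes X: "X \<in> XM" and Y: "Y \<in> XM"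
  shows "X p (\<lambda>q. \<eta> q (Y q)) = \<eta> p (D X Y p) + \<epsilon> * f p * G p (X p) (Y p)"
proof -
  have "X p (\<lambda>q. \<epsilon> * \<eta> q (Y q)) = \<epsilon> * \<eta> p (D X Y p) + f p * G p (X p) (Y p)"
    using D_metric[OF X Y xi, of p] by (simp only: g_xi Y XM_D X g_D_xi)
  then have "\<epsilon> * X p (\<lambda>q. \<eta> q (Y q)) = \<epsilon> * \<eta> p (D X Y p) + f p * G p (X p) (Y p)"
    by (simp only: tangent_cmult[OF XM_at[OF X] eta_smooth[OF Y]])
  then have "\<epsilon> * (\<epsilon> * X p (\<lambda>q. \<eta> q (Y q))) = \<epsilon> * (\<epsilon> * \<eta> p (D X Y p) + f p * G p (X p) (Y p))"
    by simp
  then show ?thesis by (simp add: distrib_left mult.assoc[symmetric] eps)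
qed

lemma deriv_G:
  assumes X: "X \<in> XM" and Y: "Y \<in> XM" and Z: "Z \<in> XM"
  shows "X p (\<lambda>q. G q (Y q) (Z q)) = G p (D X Y p) (Z p) + G p (Y p) (D X Z p)
    - f p * (G p (X p) (Y p) * \<eta> p (Z p) + G p (X p) (Z p) * \<eta> p (Y p))"
proof -
  note t = XM_at[OF X, of p]
  have "X p (\<lambda>q. G q (Y q) (Z q)) = X p (\<lambda>q. g q (Y q) (Z q))
      - \<epsilon> * (X p (\<lambda>q. \<eta> q (Y q)) * \<eta> p (Z p) + \<eta> p (Y p) * X p (\<lambda>q. \<eta> q (Z q)))"
    unfolding G_def
    by (simp only: tangent_diff[OF t] tangent_cmult[OF t] tangent_mult[OF t] CM_cmult CM_mult
        eta_smooth g_smooth Y Z)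
  moreover have "\<epsilon> * (\<epsilon> * r) = r" for r by (simp add: mult.assoc[symmetric] eps)
  ultimately show ?thesis
    by (simp add: D_metric X Y Z deriv_eta G_def[of p "D X Y p"] G_def[of p "Y p" "D X Z p"] algebra_simps)
qed

text \<open>The Lie derivatives of \<^term>\<open>\<eta>\<close> and \<^term>\<open>g\<close> along \<^term>\<open>\<xi>\<close> are \<open>0\<close> and \<open>2 f G\<close>.\<close>

lemma D_xi_field:
  assumes X: "X \<in> XM"
  shows "D \<xi> X = lb \<xi> X + fmult f (X - fmult (\<lambda>p. \<eta> p (X p)) \<xi>)"
  using D_torsion[OF xi X] D_xi[OF X] by (simp add: algebra_simps)

lemma D_xi_field_at:
  "X \<in> XM \<Longrightarrow> D \<xi> X p = lb \<xi> X p + f p *\<^sub>R (X p - \<eta> p (X p) *\<^sub>R \<xi> p)"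
  by (simp only: D_xi_field fmult_apply minus_apply plus_fun_apply)

lemma g_xi_left: "X \<in> XM \<Longrightarrow> g p (\<xi> p) (X p) = \<epsilon> * \<eta> p (X p)"
  by (simp only: g_sym[OF XM_at[OF xi] XM_at] g_xi)

lemma G_xi_left: "X \<in> XM \<Longrightarrow> G p (\<xi> p) (X p) = 0"
  by (simp only: G_sym[OF XM_at[OF xi] XM_at] G_xi)

lemma lie_eta:
  assumes X: "X \<in> XM"
  shows "\<xi> p (\<lambda>q. \<eta> q (X q)) = \<eta> p (lb \<xi> X p)"
  using deriv_eta[OF xi X, of p]
  by (simp add: D_xi_field_at X G_xi_left eta_add eta_scaleR eta_diff eta_xi XM_at XM_lb xi
      TM_scaleR TM_diff)

lemma lie_g:
  assumes X: "X \<in> XM" and Y: "Y \<in> XM"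
  shows "\<xi> p (\<lambda>q. g q (X q) (Y q)) = g p (lb \<xi> X p) (Y p) + g p (X p) (lb \<xi> Y p) + 2 * f p * G p (X p) (Y p)"
  by (simp add: D_metric xi X Y D_xi_field_at g_add_left g_add_right g_scaleR_left g_scaleR_right
      g_diff_left g_diff_right XM_at XM_lb TM_scaleR TM_diff g_xi g_xi_left G_def)
     (simp add: algebra_simps)

end

section \<open>Rigidity of the Ricci tensor for a constant torse-forming function\<close>

text \<open>Constancy of \<open>f\<close> is required in the form of vanishing derivatives only; on a disconnected
  manifold \<open>f\<close> may then still take several values.\<close>

locale torse_forming_constant = torse_forming_unit A g D \<xi> \<eta> \<epsilon> f
  for A :: "('m::{t2_space,second_countable_topology}, 'e::euclidean_space) chart set"
    and g D \<xi> \<eta> \<epsilon> f +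
  assumes f_const: "X \<in> XM \<Longrightarrow> X p f = 0"
begin

lemma R_xi_xi:
  assumes X: "X \<in> XM"
  shows "R X \<xi> \<xi> p = - (f p)\<^sup>2 *\<^sub>R X p + ((f p)\<^sup>2 * \<eta> p (X p)) *\<^sub>R \<xi> p"
proof -
  let ?e = "\<lambda>p. \<eta> p (X p)"
  have e: "?e \<in> CM" by (rule eta_smooth[OF X])
  have D0: "D \<xi> \<xi> = fmult (\<lambda>_. 0) \<xi>"
    by (rule ext) (simp add: D_xi_at[OF xi] eta_xi)
  have 1: "D X (D \<xi> \<xi>) p = 0"
    unfolding D0 by (simp add: D_fmult_right CM_const X xi tangent_const[OF XM_at[OF X]])
  have De: "D \<xi> (fmult ?e \<xi>) p = \<eta> p (lb \<xi> X p) *\<^sub>R \<xi> p"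
    by (simp add: D_fmult_right e xi lie_eta X D0)
  have 2: "D \<xi> (D X \<xi>) p = f p *\<^sub>R (D \<xi> X p - \<eta> p (lb \<xi> X p) *\<^sub>R \<xi> p)"
    unfolding D_xi[OF X]
    by (simp add: D_fmult_right[OF f] X xi e XM_diff XM_fmult D_diff_right f_const De)
  have 3: "D (lb X \<xi>) \<xi> p = - f p *\<^sub>R (lb \<xi> X p - \<eta> p (lb \<xi> X p) *\<^sub>R \<xi> p)"
  proof -
    have "lb X \<xi> = fmult (\<lambda>_. -1) (lb \<xi> X)"
      by (rule ext) (simp add: lb_swap[OF X xi])
    then show ?thesis
      by (simp add: D_fmult_left CM_const XM_lb X xi D_xi_at)
  qed
  show ?thesis
    unfolding curvature_def minus_apply 1 2 3 D_xi_field_at[OF X]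
    by (rule ext) (simp add: algebra_simps power2_eq_square)
qed

lemma ricci_xi_xi: "ricci A D \<xi> \<xi> p = - (f p)\<^sup>2 * (DIM('e) - 1)"
proof -
  have t: "tensorial_at p (\<lambda>X. (f p)\<^sup>2 * \<eta> p (X p))"
    by (rule tensorial_atI)
       (simp_all add: eta_add eta_scaleR XM_at distrib_left)
  have "ricci A D \<xi> \<xi> p = - (f p)\<^sup>2 * DIM('e) + (f p)\<^sup>2 * \<eta> p (\<xi> p)"
    unfolding ricci_eq_tr by (rule tr_scalar_plus_rank_one[OF t xi]) (rule R_xi_xi)
  then show ?thesis by (simp add: eta_xi algebra_simps)
qed

text \<open>The Lie derivative of the connection.  Let \<open>M(X,Y)\<close> be the difference of the two sides.  It is
  symmetric in \<open>X, Y\<close> because \<open>D\<close> is torsion free, and \<open>g(M(X,Y),Z)\<close> is skew in \<open>Y, Z\<close>, as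
  differentiation of the metric property of \<open>D\<close> along \<open>\<xi>\<close> shows; a form with both symmetries
  vanishes.\<close>

lemma lie_D:
  assumes X: "X \<in> XM" and Y: "Y \<in> XM"
  shows "lb \<xi> (D X Y) = D (lb \<xi> X) Y + D X (lb \<xi> Y)
    - fmult (\<lambda>p. 2 * \<epsilon> * (f p)\<^sup>2 * G p (X p) (Y p)) \<xi>"
proof
  fix p
  define N where "N X Y = lb \<xi> (D X Y) - D (lb \<xi> X) Y - D X (lb \<xi> Y)" for X Y
  define M where "M X Y = N X Y p + (2 * \<epsilon> * (f p)\<^sup>2 * G p (X p) (Y p)) *\<^sub>R \<xi> p" for X Y
  define t where "t X Y Z = g p (M X Y) (Z p)" for X Y Z
  have NX: "N X Y \<in> XM" if "X \<in> XM" "Y \<in> XM" for X Y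
    unfolding N_def using that by (simp only: XM_diff XM_D XM_lb xi)
  have MT: "M X Y \<in> TM p" if "X \<in> XM" "Y \<in> XM" for X Y
    unfolding M_def using that by (simp only: TM_add TM_scaleR XM_at NX xi)
  have sym: "M X Y = M Y X" if X: "X \<in> XM" and Y: "Y \<in> XM" for X Y
  proof -
    note m = X Y xi XM_lb[OF xi X] XM_lb[OF xi Y] XM_D[OF X Y] XM_D[OF Y X]
    have "lb \<xi> (D X Y) - lb \<xi> (D Y X) = lb \<xi> (lb X Y)"
      by (simp only: D_torsion[OF X Y] lb_diff_right m)
    also have "\<dots> = lb (lb \<xi> X) Y + lb X (lb \<xi> Y)" by (rule lb_jacobi[OF xi X Y])
    also have "\<dots> = (D (lb \<xi> X) Y - D Y (lb \<xi> X)) + (D X (lb \<xi> Y) - D (lb \<xi> Y) X)"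
      by (simp only: D_torsion[OF XM_lb[OF xi X] Y] D_torsion[OF X XM_lb[OF xi Y]])
    finally have "N X Y = N Y X" unfolding N_def by (simp add: algebra_simps)
    then show ?thesis by (simp only: M_def G_sym[OF XM_at[OF X] XM_at[OF Y]])
  qed
  have skew: "t X Y Z + t X Z Y = 0" if X: "X \<in> XM" and Y: "Y \<in> XM" and Z: "Z \<in> XM" for X Y Z
  proof -
    note m = X Y Z xi XM_lb[OF xi X] XM_lb[OF xi Y] XM_lb[OF xi Z] XM_D[OF X Y] XM_D[OF X Z]
    note v = XM_at[OF X, of p] XM_at[OF xi, of p]
    \<comment> \<open>Differentiate the metric identity for \<open>X\<close> along \<open>\<xi>\<close> and \<open>lie_g\<close> along \<open>X\<close>; by the definition
      of the bracket the two results differ by the metric identity for \<open>lb \<xi> X\<close>.\<close>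
    have a: "\<xi> p (\<lambda>q. X q (\<lambda>r. g r (Y r) (Z r))) =
      g p (lb \<xi> (D X Y) p) (Z p) + g p (D X Y p) (lb \<xi> Z p) + 2 * f p * G p (D X Y p) (Z p)
      + (g p (lb \<xi> Y p) (D X Z p) + g p (Y p) (lb \<xi> (D X Z) p) + 2 * f p * G p (Y p) (D X Z p))"
      by (simp only: D_metric[OF X] m tangent_add[OF v(2)] g_smooth lie_g)
    have c: "(\<lambda>q. 2 * f q * G q (Y q) (Z q)) \<in> CM"
      by (intro CM_mult CM_cmult f G_smooth m)
    have d: "X p (\<lambda>q. 2 * f q * G q (Y q) (Z q)) = 2 * f p * X p (\<lambda>q. G q (Y q) (Z q))"
      by (simp only: tangent_mult[OF v(1)] tangent_cmult[OF v(1)] CM_cmult f G_smooth m f_const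
          mult_zero_right mult_zero_left add_0)
    have b: "X p (\<lambda>q. \<xi> q (\<lambda>r. g r (Y r) (Z r))) =
      g p (D X (lb \<xi> Y) p) (Z p) + g p (lb \<xi> Y p) (D X Z p)
      + (g p (D X Y p) (lb \<xi> Z p) + g p (Y p) (D X (lb \<xi> Z) p))
      + 2 * f p * X p (\<lambda>q. G q (Y q) (Z q))"
      by (simp only: lie_g m tangent_add[OF v(1)] CM_add g_smooth c d D_metric[OF X])
    have e: "\<xi> p (\<lambda>q. X q (\<lambda>r. g r (Y r) (Z r))) - X p (\<lambda>q. \<xi> q (\<lambda>r. g r (Y r) (Z r)))
      = g p (D (lb \<xi> X) Y p) (Z p) + g p (Y p) (D (lb \<xi> X) Z p)"
      using D_metric[of "lb \<xi> X" Y Z p] by (simp only: m lb_apply g_smooth)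
    have n: "g p (N X Y p) (Z p) + g p (Y p) (N X Z p)
      = - 2 * (f p)\<^sup>2 * (G p (X p) (Y p) * \<eta> p (Z p) + G p (X p) (Z p) * \<eta> p (Y p))"
      using e unfolding a b deriv_G[OF X Y Z] N_def
      by (simp add: g_diff_left g_diff_right TM_diff XM_at XM_lb XM_D m)
         (simp add: power2_eq_square algebra_simps)
    have s: "g p (M X Z) (Y p) = g p (Y p) (M X Z)" by (rule g_sym[OF MT XM_at]) (rule m)+
    have ee: "\<epsilon> * (\<epsilon> * r) = r" for r by (simp add: mult.assoc[symmetric] eps)
    show ?thesis
      unfolding t_def s unfolding M_def using n
      by (simp add: g_add_left g_add_right g_scaleR_left g_scaleR_right TM_scaleR XM_at NX m g_xi g_xi_left)
         (simp add: algebra_simps ee)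
  qed
  have "M X Y = 0"
  proof (rule g_nondegenerate[OF MT[OF X Y]])
    fix v assume "v \<in> TM p"
    then obtain Z where Z: "Z \<in> XM" "Z p = v" by (rule vector_field_through)
    have "t X Y Z = - t X Z Y" "t Z X Y = - t Z Y X" "t Y Z X = - t Y X Z"
      using skew[OF X Y Z(1)] skew[OF Z(1) X Y] skew[OF Y Z(1) X] by linarith+
    moreover have "t X Z Y = t Z X Y" "t Z Y X = t Y Z X" "t Y X Z = t X Y Z"
      using sym X Y Z(1) by (simp_all only: t_def)
    ultimately have "t X Y Z = 0" by linarith
    then show "g p (M X Y) v = 0" by (simp only: t_def Z(2))
  qed
  then show "lb \<xi> (D X Y) p = (D (lb \<xi> X) Y + D X (lb \<xi> Y)
      - fmult (\<lambda>p. 2 * \<epsilon> * (f p)\<^sup>2 * G p (X p) (Y p)) \<xi>) p"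
    by (simp add: M_def N_def algebra_simps)
qed

lemma deriv_sq_f_G:
  assumes "X \<in> XM" "Y \<in> XM" "Z \<in> XM"
  shows "(\<lambda>q. 2 * \<epsilon> * (f q)\<^sup>2 * G q (Y q) (Z q)) \<in> CM"
    and "X p (\<lambda>q. 2 * \<epsilon> * (f q)\<^sup>2 * G q (Y q) (Z q)) = 2 * \<epsilon> * (f p)\<^sup>2 * X p (\<lambda>q. G q (Y q) (Z q))"
proof -
  have c: "(\<lambda>q. 2 * \<epsilon> * (f q)\<^sup>2) \<in> CM"
    unfolding power2_eq_square by (intro CM_cmult CM_mult f)
  then show "(\<lambda>q. 2 * \<epsilon> * (f q)\<^sup>2 * G q (Y q) (Z q)) \<in> CM"
    by (rule CM_mult) (rule G_smooth[OF assms(2,3)])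
  have "X p (\<lambda>q. 2 * \<epsilon> * (f q)\<^sup>2) = 0"
    unfolding power2_eq_square
    by (simp add: tangent_cmult[OF XM_at[OF assms(1)] CM_mult[OF f f]]
        tangent_mult[OF XM_at[OF assms(1)] f f] f_const assms(1))
  then show "X p (\<lambda>q. 2 * \<epsilon> * (f q)\<^sup>2 * G q (Y q) (Z q)) = 2 * \<epsilon> * (f p)\<^sup>2 * X p (\<lambda>q. G q (Y q) (Z q))"
    by (simp add: tangent_mult[OF XM_at[OF assms(1)] c G_smooth[OF assms(2,3)]])
qed

text \<open>The Lie derivative of the curvature follows by moving \<open>L\<^sub>\<xi>\<close> past each of the two covariant
  derivatives with the previous formula and past the bracket with the Jacobi identity.  The terms in the
  direction of \<open>\<xi>\<close> cancel.\<close>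

lemma lie_R:
  assumes X: "X \<in> XM" and Y: "Y \<in> XM" and Z: "Z \<in> XM"
  shows "lb \<xi> (R X Y Z) p = R (lb \<xi> X) Y Z p + R X (lb \<xi> Y) Z p + R X Y (lb \<xi> Z) p
    + ((- 2 * \<epsilon> * (f p) ^ 3 * G p (Y p) (Z p)) *\<^sub>R X p
      + (2 * \<epsilon> * (f p) ^ 3 * G p (X p) (Z p)) *\<^sub>R Y p)"
proof -
  define k where "k X Y = (\<lambda>p. 2 * \<epsilon> * (f p)\<^sup>2 * G p (X p) (Y p))" for X Y
  have kC: "k X Y \<in> CM" if "X \<in> XM" "Y \<in> XM" for X Y
    unfolding k_def by (rule deriv_sq_f_G(1)[OF that(1) that])
  note kd = deriv_sq_f_G(2)[folded k_def]
  note lie_Dk = lie_D[folded k_def]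
  have DD: "lb \<xi> (D X (D Y Z)) p = D (lb \<xi> X) (D Y Z) p + D X (D (lb \<xi> Y) Z) p + D X (D Y (lb \<xi> Z)) p
      - k Y Z p *\<^sub>R D X \<xi> p - X p (k Y Z) *\<^sub>R \<xi> p - k X (D Y Z) p *\<^sub>R \<xi> p"
    if X: "X \<in> XM" and Y: "Y \<in> XM" for X Y
  proof -
    note m = X Y Z xi XM_lb[OF xi X] XM_lb[OF xi Y] XM_lb[OF xi Z] XM_D
    show ?thesis
      unfolding lie_Dk[OF X XM_D[OF Y Z]] lie_Dk[OF Y Z]
      by (simp only: D_diff_right D_add_right D_fmult_right kC m XM_add XM_diff XM_fmult
          plus_fun_apply minus_apply fmult_apply) (rule ext, simp add: algebra_simps)
  qed
  have DB: "lb \<xi> (D (lb X Y) Z) p = D (lb (lb \<xi> X) Y) Z p + D (lb X (lb \<xi> Y)) Z p + D (lb X Y) (lb \<xi> Z) p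
      - k (lb X Y) Z p *\<^sub>R \<xi> p"
    unfolding lie_Dk[OF XM_lb[OF X Y] Z] lb_jacobi[OF xi X Y]
    by (simp only: D_add_left XM_lb X Y Z xi plus_fun_apply minus_apply fmult_apply)
  have Gb: "G p (lb X Y p) (Z p) = G p (D X Y p) (Z p) - G p (D Y X p) (Z p)"
    using G_add_left[OF XM_at[OF XM_lb[OF X Y]] XM_at[OF XM_D[OF Y X]] XM_at[OF Z], of p]
    by (simp add: D_torsion[OF X Y])
  have "lb \<xi> (R X Y Z) p = lb \<xi> (D X (D Y Z)) p - lb \<xi> (D Y (D X Z)) p - lb \<xi> (D (lb X Y) Z) p"
    by (simp only: curvature_def lb_diff_right xi XM_diff XM_D XM_lb X Y Z minus_apply)
  then show ?thesis
    unfolding DD[OF X Y] DD[OF Y X] DB kd[OF X Y Z] kd[OF Y X Z] deriv_G[OF X Y Z] deriv_G[OF Y X Z]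
      D_xi_at[OF X] D_xi_at[OF Y] curvature_def minus_apply lb_swap[OF Y X]
    unfolding k_def Gb G_sym[OF XM_at[OF Y] XM_at[OF X]]
    by (simp only:) (rule ext, simp add: algebra_simps power2_eq_square power3_eq_cube)
qed

text \<open>The trace of \<open>lie_R\<close> is \<open>L\<^sub>\<xi> S = - 2 \<epsilon> (n - 1) f\<^sup>3 G\<close>, whereas the form of \<open>S\<close> gives
  \<open>L\<^sub>\<xi> S = 2 f \<alpha> G\<close>.  So \<open>f (\<epsilon> \<alpha> + (n - 1) f\<^sup>2) = 0\<close>, and the bracket is \<open>- \<gamma>\<close> by the value of
  \<open>S(\<xi>,\<xi>)\<close>.\<close>

lemma ricci_rigidity:
  assumes \<alpha>: "\<alpha> \<in> CM" "\<And>X p. X \<in> XM \<Longrightarrow> X p \<alpha> = 0"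
    and \<gamma>: "\<gamma> \<in> CM" "\<And>X p. X \<in> XM \<Longrightarrow> X p \<gamma> = 0"
    and S: "\<And>Y Z p. Y \<in> XM \<Longrightarrow> Z \<in> XM \<Longrightarrow>
      ricci A D Y Z p = \<alpha> p * g p (Y p) (Z p) + \<gamma> p * (\<eta> p (Y p) * \<eta> p (Z p))"
    and Y: "Y \<in> XM" and Z: "Z \<in> XM" and G: "G p (Y p) (Z p) \<noteq> 0"
  shows "f p * \<gamma> p = 0"
proof -
  note m = Y Z xi XM_lb[OF xi Y] XM_lb[OF xi Z]
  note v = XM_at[OF xi, of p]
  have Seq: "(\<lambda>q. ricci A D Y Z q) = (\<lambda>q. \<alpha> q * g q (Y q) (Z q) + \<gamma> q * (\<eta> q (Y q) * \<eta> q (Z q)))"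
    by (rule ext) (rule S[OF Y Z])
  have SC: "(\<lambda>q. ricci A D Y Z q) \<in> CM"
    unfolding Seq by (intro CM_add CM_mult \<alpha> \<gamma> g_smooth eta_smooth Y Z)
  have "\<xi> p (\<lambda>q. ricci A D Y Z q) = \<alpha> p * \<xi> p (\<lambda>q. g q (Y q) (Z q))
      + \<gamma> p * (\<xi> p (\<lambda>q. \<eta> q (Y q)) * \<eta> p (Z p) + \<eta> p (Y p) * \<xi> p (\<lambda>q. \<eta> q (Z q)))"
    unfolding Seq
    by (simp add: tangent_add[OF v] tangent_mult[OF v] CM_mult \<alpha> \<gamma> g_smooth eta_smooth m)
  then have 1: "\<xi> p (\<lambda>q. ricci A D Y Z q) = ricci A D (lb \<xi> Y) Z p + ricci A D Y (lb \<xi> Z) p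
      + 2 * f p * \<alpha> p * G p (Y p) (Z p)"
    by (simp only: S m lie_g lie_eta) (simp add: algebra_simps)
  \<comment> \<open>The part of the Lie derivative of \<open>R\<close> that remains after the two Ricci terms above are split off.\<close>
  let ?W = "\<lambda>X. (- 2 * \<epsilon> * (f p) ^ 3 * G p (Y p) (Z p)) *\<^sub>R X p
      + (2 * \<epsilon> * (f p) ^ 3 * G p (X p) (Z p)) *\<^sub>R Y p"
  have \<omega>: "tensorial_at p (\<lambda>X. 2 * \<epsilon> * (f p) ^ 3 * G p (X p) (Z p))"
    by (rule tensorial_atI) (simp_all add: G_add_left G_scaleR_left XM_at Z distrib_left)
  have tW: "tensorial_at p ?W"
    by (rule tensorial_atI)
       (simp_all add: G_add_left G_scaleR_left XM_at Z, simp_all add: fun_eq_iff algebra_simps)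
  have mW: "?W X \<in> TM p" if "X \<in> XM" for X
    by (intro TM_add TM_scaleR XM_at that Y)
  note tS = R_tensorial[OF XM_lb[OF xi Y] Z, of p] R_tensorial[OF Y XM_lb[OF xi Z], of p]
  have mS: "R X (lb \<xi> Y) Z p \<in> TM p" "R X Y (lb \<xi> Z) p \<in> TM p" if "X \<in> XM" for X
    by (rule XM_at[OF XM_R], rule that, rule m, rule m)+
  have t2: "tensorial_at p (\<lambda>X. R X (lb \<xi> Y) Z p + R X Y (lb \<xi> Z) p)"
    by (rule tensorial_at_plus[OF tS])
  have m2: "R X (lb \<xi> Y) Z p + R X Y (lb \<xi> Z) p \<in> TM p" if "X \<in> XM" for X
    by (rule TM_add[OF mS[OF that]])
  have t3: "tensorial_at p (\<lambda>X. R X (lb \<xi> Y) Z p + R X Y (lb \<xi> Z) p + ?W X)"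
    by (rule tensorial_at_plus[OF t2 tW])
  have m3: "R X (lb \<xi> Y) Z p + R X Y (lb \<xi> Z) p + ?W X \<in> TM p" if "X \<in> XM" for X
    by (rule TM_add[OF m2[OF that] mW[OF that]])
  have "\<xi> p (\<lambda>q. ricci A D Y Z q) = tr p (\<lambda>X. lb \<xi> (R X Y Z) p - R (lb \<xi> X) Y Z p)"
    unfolding ricci_eq_tr
    by (rule deriv_tr[OF xi XM_R[OF _ Y Z] R_tensorial[OF Y Z] SC[unfolded ricci_eq_tr]])
  also have "\<dots> = tr p (\<lambda>X. R X (lb \<xi> Y) Z p + R X Y (lb \<xi> Z) p + ?W X)"
    by (rule tr_cong_on_XM[OF t3 m3]) (simp_all only: lie_R Y Z, simp only: algebra_simps)
  also have "\<dots> = ricci A D (lb \<xi> Y) Z p + ricci A D Y (lb \<xi> Z) p + tr p ?W"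
  proof -
    have "tr p (\<lambda>X. R X (lb \<xi> Y) Z p + R X Y (lb \<xi> Z) p)
        = tr p (\<lambda>X. R X (lb \<xi> Y) Z p) + tr p (\<lambda>X. R X Y (lb \<xi> Z) p)"
      by (rule tr_add[OF tS(1) _ tS(2)]) (erule mS)+
    moreover have "tr p (\<lambda>X. R X (lb \<xi> Y) Z p + R X Y (lb \<xi> Z) p + ?W X)
        = tr p (\<lambda>X. R X (lb \<xi> Y) Z p + R X Y (lb \<xi> Z) p) + tr p ?W"
      by (rule tr_add[OF t2 _ tW]) (erule m2, erule mW)
    ultimately show ?thesis by (simp only: ricci_eq_tr)
  qed
  also have "tr p ?W = - 2 * \<epsilon> * (f p) ^ 3 * G p (Y p) (Z p) * DIM('e) + 2 * \<epsilon> * (f p) ^ 3 * G p (Y p) (Z p)"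
    by (rule tr_scalar_plus_rank_one[OF \<omega> Y]) (rule refl)
  finally have "(f p * (\<alpha> p + \<epsilon> * (f p)\<^sup>2 * (DIM('e) - 1))) * G p (Y p) (Z p) = 0"
    using 1 by (simp add: algebra_simps power2_eq_square power3_eq_cube)
  then have "\<epsilon> * (f p * (\<alpha> p + \<epsilon> * (f p)\<^sup>2 * (DIM('e) - 1))) = 0" using G by simp
  moreover have "\<epsilon> * \<alpha> p + \<gamma> p = - (f p)\<^sup>2 * (DIM('e) - 1)"
    using ricci_xi_xi[of p] by (simp add: S xi g_xi eta_xi mult.commute)
  ultimately show ?thesis using eps by algebra
qed

end

section \<open>One-dimensional tangent spaces\<close>

context manifold
begin

text \<open>Compare two evaluations of the trace of the identity.\<close>

lemma DIM_eq_1_if_rank_one: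
  assumes \<omega>: "tensorial_at p (\<omega> :: 'm vfield \<Rightarrow> real)" and V: "V \<in> XM" "\<omega> V = 1"
    and X: "\<And>X. X \<in> XM \<Longrightarrow> X p = \<omega> X *\<^sub>R V p"
  shows "DIM('e) = 1"
proof -
  have z: "tensorial_at p (\<lambda>X. 0 :: real)" by (rule tensorial_atI) simp_all
  have "tr p (\<lambda>X. X p) = (1::real) * DIM('e) + 0"
    by (rule tr_scalar_plus_rank_one[OF z V(1)]) simp
  moreover have "tr p (\<lambda>X. X p) = (0::real) * DIM('e) + \<omega> V"
    by (rule tr_scalar_plus_rank_one[OF \<omega> V(1)]) (simp only: scaleR_zero_left add_0, erule X)
  ultimately show ?thesis using V(2) by simp
qed

lemma tangent_line:
  assumes dim: "DIM('e) = 1" and u: "u \<in> TM p" "u \<noteq> 0" and v: "v \<in> TM p"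
  obtains t where "v = t *\<^sub>R u"
proof -
  obtain E y N where fr: "coord_frame E y N" "p \<in> N" using coord_frame_exists .
  obtain e :: 'e where e: "Basis = {e}" using dim card_1_singletonE by blast
  have ex: "w = w (y e) *\<^sub>R E e p" if "w \<in> TM p" for w
    using coord_frameD(5)[OF fr that] by (simp add: e)
  have "u (y e) \<noteq> 0" using ex[OF u(1)] u(2) by (metis scaleR_zero_left)
  then have "E e p = inverse (u (y e)) *\<^sub>R u"
    using arg_cong[OF ex[OF u(1)], of "\<lambda>w. inverse (u (y e)) *\<^sub>R w"] by (simp only: scaleR_scaleR) simp
  then have "v = (v (y e) * inverse (u (y e))) *\<^sub>R u"
    using ex[OF v] by (simp only: scaleR_scaleR)
  then show thesis by (rule that)
qed

end

text \<open>\<open>G\<close> vanishes at a point exactly if \<open>\<xi>\<close> spans the tangent space there, which can be read off the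
  dimension and is therefore the same at all points.\<close>

lemma (in torse_forming_unit) G_nonzero_everywhere:
  assumes X: "X \<in> XM" and Y: "Y \<in> XM" and G: "G p (X p) (Y p) \<noteq> 0"
  shows "DIM('e) \<noteq> 1" and "\<exists>X\<in>XM. \<exists>Y\<in>XM. G q (X q) (Y q) \<noteq> 0"
proof -
  show n: "DIM('e) \<noteq> 1"
  proof
    assume "DIM('e) = 1"
    moreover have "\<xi> p \<noteq> 0" using eta_xi[of p] eta_scaleR[OF XM_at[OF xi], of p 0] by (metis mult_zero_left scaleR_zero_left zero_neq_one)
    ultimately obtain t where "X p = t *\<^sub>R \<xi> p"
      using tangent_line XM_at[OF xi] XM_at[OF X] by metis
    then show False using G by (simp only: G_scaleR_left[OF XM_at[OF xi] XM_at[OF Y]] G_xi_left[OF Y] mult_zero_right simp_thms)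
  qed
  show "\<exists>X\<in>XM. \<exists>Y\<in>XM. G q (X q) (Y q) \<noteq> 0"
  proof (rule ccontr)
    assume "\<not> ?thesis"
    then have G0: "G q (X q) (Y q) = 0" if "X \<in> XM" "Y \<in> XM" for X Y using that by blast
    have "X q = \<eta> q (X q) *\<^sub>R \<xi> q" if X: "X \<in> XM" for X
    proof -
      note t = XM_at[OF X, of q] XM_at[OF xi, of q]
      have "X q - \<eta> q (X q) *\<^sub>R \<xi> q = 0"
      proof (rule g_nondegenerate[of _ q])
        show "X q - \<eta> q (X q) *\<^sub>R \<xi> q \<in> TM q" by (intro TM_diff TM_scaleR t)
        fix v assume v: "v \<in> TM q"
        then obtain Y where Y: "Y \<in> XM" "Y q = v" by (rule vector_field_through)
        show "g q (X q - \<eta> q (X q) *\<^sub>R \<xi> q) v = 0"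
          using G0[OF X Y(1)] g_xi_left[OF Y(1), of q] v
          by (simp add: g_diff_left g_scaleR_left TM_scaleR t G_def Y(2))
      qed
      then show ?thesis by simp
    qed
    moreover have "tensorial_at q (\<lambda>X. \<eta> q (X q))"
      by (rule tensorial_atI) (simp_all add: eta_add eta_scaleR XM_at)
    ultimately have "DIM('e) = 1" using DIM_eq_1_if_rank_one xi eta_xi by blast
    with n show False by simp
  qed
qed

theorem theorem3p4:
  fixes A :: "('m::{t2_space,second_countable_topology}, 'e::euclidean_space) chart set"
    and \<phi> :: "'m \<Rightarrow> 'm tangent \<Rightarrow> 'm tangent"
    and \<xi> :: "'m vfield"
    and \<eta> :: "'m \<Rightarrow> 'm tangent \<Rightarrow> real"
    and g :: "'m \<Rightarrow> 'm tangent \<Rightarrow> 'm tangent \<Rightarrow> real"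
    and D :: "'m vfield \<Rightarrow> 'm vfield \<Rightarrow> 'm vfield"
    and \<epsilon> a b c l \<mu> :: real
  assumes manifold: "smooth_atlas A"
    and paracontact: "almost_paracontact_metric A \<phi> \<xi> \<eta> g \<epsilon>"
    and levi_civita: "levi_civita_connection A g D"
    and einstein: "einstein_like A \<phi> \<eta> g D a b c"
    and soliton: "eta_ricci_soliton A \<eta> D g \<xi> l \<mu>"
    and torse: "torse_forming A D \<xi>"
  shows "eta_einstein A \<eta> g D"
proof -
  have phi: "tensor_field_11 A \<phi>" and xi: "\<xi> \<in> vector_fields A" and eta: "one_form A \<eta>"
    and metric: "pseudo_riemannian_metric A g" and eps: "\<epsilon> \<in> {1, -1}"
    and phi_phi: "\<And>X p. X \<in> vector_fields A \<Longrightarrow> \<phi> p (\<phi> p (X p)) = X p - \<eta> p (X p) *\<^sub>R \<xi> p"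
    and eta_xi: "\<And>p. \<eta> p (\<xi> p) = 1" and phi_xi: "\<And>p. \<phi> p (\<xi> p) = 0"
    and eta_phi: "\<And>X p. X \<in> vector_fields A \<Longrightarrow> \<eta> p (\<phi> p (X p)) = 0"
    and g_phi: "\<And>X Y p. X \<in> vector_fields A \<Longrightarrow> Y \<in> vector_fields A \<Longrightarrow>
      g p (\<phi> p (X p)) (\<phi> p (Y p)) = g p (X p) (Y p) - \<epsilon> * \<eta> p (X p) * \<eta> p (Y p)"
    using paracontact unfolding almost_paracontact_metric_def by simp_all
  interpret levi_civita A g D
    using manifold metric levi_civita by unfold_locales
  have eps2: "\<epsilon> * \<epsilon> = 1" using eps by auto
  have phi_XM: "(\<lambda>p. \<phi> p (X p)) \<in> XM" if "X \<in> XM" for X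
    using phi that unfolding tensor_field_11_def by blast
  have g_xi: "g p (X p) (\<xi> p) = \<epsilon> * \<eta> p (X p)" if X: "X \<in> XM" for X p
  proof -
    have "g p (\<phi> p (X p)) (0 *\<^sub>R \<xi> p) = 0"
      using g_scaleR_right[OF XM_at[OF phi_XM[OF X]] XM_at[OF xi], of p 0] by (simp only: mult_zero_left)
    then have "g p (\<phi> p (X p)) (\<phi> p (\<xi> p)) = 0" by (simp only: phi_xi scaleR_zero_left)
    then show ?thesis using g_phi[OF X xi, of p] by (simp add: eta_xi)
  qed
  obtain f w where f: "f \<in> CM" and w: "\<And>X p. X \<in> XM \<Longrightarrow> D X \<xi> p = f p *\<^sub>R X p + w p (X p) *\<^sub>R \<xi> p"
    using torse unfolding torse_forming_def by blast
  \<comment> \<open>As \<open>g(\<xi>, \<xi>) = \<epsilon>\<close> is constant, \<open>D X \<xi>\<close> is orthogonal to \<open>\<xi>\<close>; this determines \<open>w = - f \<eta>\<close>.\<close>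
  have w_eq: "w p (X p) = - (f p * \<eta> p (X p))" if X: "X \<in> XM" for X p
  proof -
    have "2 * g p (D X \<xi> p) (\<xi> p) = X p (\<lambda>q. g q (\<xi> q) (\<xi> q))"
      by (simp add: D_metric[OF X xi xi] g_sym[OF XM_at[OF xi] XM_at[OF XM_D[OF X xi]]])
    also have "\<dots> = 0"
      by (simp add: g_xi xi eta_xi tangent_const[OF XM_at[OF X]])
    finally have "\<epsilon> * (f p * \<eta> p (X p) + w p (X p)) = 0"
      by (simp add: w X g_add_left g_scaleR_left TM_scaleR XM_at xi g_xi eta_xi algebra_simps)
    then show ?thesis using eps2 by auto
  qed
  interpret torse_forming_unit A g D \<xi> \<eta> \<epsilon> f
  proof
    show "D X \<xi> = fmult f (X - fmult (\<lambda>p. \<eta> p (X p)) \<xi>)" if "X \<in> XM" for X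
      by (intro ext) (simp add: w w_eq that algebra_simps)
  qed (fact xi eta eps2 eta_xi f | erule g_xi)+
  have S: "ricci A D X Y p = a * g p (X p) (Y p) + b * g p (\<phi> p (X p)) (Y p) + c * \<eta> p (X p) * \<eta> p (Y p)"
    if "X \<in> XM" "Y \<in> XM" for X Y p
    using einstein that unfolding einstein_like_def by blast
  have sol: "f p * G p (X p) (Y p) + ricci A D X Y p + l * g p (X p) (Y p) + \<mu> * \<eta> p (X p) * \<eta> p (Y p) = 0"
    if X: "X \<in> XM" and Y: "Y \<in> XM" for X Y p
  proof -
    have "lie_derivative_metric A g \<xi> X Y p = 2 * f p * G p (X p) (Y p)"
      by (simp add: lie_derivative_metric_def lie_g X Y)
    moreover have "1 / 2 * lie_derivative_metric A g \<xi> X Y p + ricci A D X Y p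
          + l * g p (X p) (Y p) + \<mu> * \<eta> p (X p) * \<eta> p (Y p) = 0"
      using soliton X Y unfolding eta_ricci_soliton_def by blast
    ultimately show ?thesis by simp
  qed
  define h where "h p = f p + a + l" for p
  have g_eq: "g p u v = G p u v + \<epsilon> * (\<eta> p u * \<eta> p v)" for p u v by (simp add: G_def)
  have g_phi_xi: "g p (\<phi> p (\<xi> p)) (\<xi> p) = 0" for p
    using g_xi[OF phi_XM[OF xi], of p] by (simp only: eta_phi[OF xi] mult_zero_right)
  have const: "a * \<epsilon> + c + l * \<epsilon> + \<mu> = 0"
    using sol[OF xi xi] S[OF xi xi] by (simp add: g_phi_xi G_xi xi eta_xi g_xi)
  have hG: "h p * G p (X p) (Y p) + b * g p (\<phi> p (X p)) (Y p) = 0" if X: "X \<in> XM" and Y: "Y \<in> XM" for X Y p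
  proof -
    have "h p * G p (X p) (Y p) + b * g p (\<phi> p (X p)) (Y p)
        + (a * \<epsilon> + c + l * \<epsilon> + \<mu>) * (\<eta> p (X p) * \<eta> p (Y p)) = 0"
      using sol[OF X Y, of p] unfolding S[OF X Y] h_def g_eq[of p "X p"] by (simp add: algebra_simps)
    then show ?thesis by (simp add: const)
  qed
  \<comment> \<open>Replacing \<open>X\<close> by \<open>\<phi> X\<close> exchanges the two terms.\<close>
  have h2: "(h p * h p - b * b) * G p (X p) (Y p) = 0" if X: "X \<in> XM" and Y: "Y \<in> XM" for X Y p
  proof -
    have "g p (\<phi> p (\<phi> p (X p))) (Y p) = G p (X p) (Y p)"
      by (simp add: phi_phi X g_diff_left g_scaleR_left TM_scaleR XM_at xi Y g_xi_left G_def)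
    moreover have "G p (\<phi> p (X p)) (Y p) = g p (\<phi> p (X p)) (Y p)"
      by (simp add: G_def eta_phi X)
    ultimately have "h p * g p (\<phi> p (X p)) (Y p) + b * G p (X p) (Y p) = 0"
      using hG[OF phi_XM[OF X] Y, of p] by simp
    with hG[OF X Y, of p] show ?thesis by algebra
  qed
  have Sh: "ricci A D X Y p = (a - h p) * g p (X p) (Y p) + (c + \<epsilon> * h p) * (\<eta> p (X p) * \<eta> p (Y p))"
    if X: "X \<in> XM" and Y: "Y \<in> XM" for X Y p
    using hG[OF X Y, of p] unfolding S[OF X Y] G_def by (simp add: algebra_simps)
  show ?thesis
  proof (cases "b = 0")
    case True
    then show ?thesis unfolding eta_einstein_def
      by (intro exI[of _ a] exI[of _ c]) (simp add: S)
  next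
    case b: False
    show ?thesis
    proof (cases "\<exists>p. \<exists>X\<in>XM. \<exists>Y\<in>XM. G p (X p) (Y p) \<noteq> 0")
      case False
      then have G0: "G p (X p) (Y p) = 0" if "X \<in> XM" "Y \<in> XM" for X Y p
        using that by blast
      have "g p (\<phi> p (X p)) (Y p) = 0" if "X \<in> XM" "Y \<in> XM" for X Y p
        using hG[OF that, of p] b by (simp add: G0 that)
      then show ?thesis unfolding eta_einstein_def
        by (intro exI[of _ a] exI[of _ c]) (simp add: S)
    next
      case True
      then obtain p0 X0 Y0 where "X0 \<in> XM" "Y0 \<in> XM" "G p0 (X0 p0) (Y0 p0) \<noteq> 0" by blast
      note dim = G_nonzero_everywhere[OF this]
      have hh: "h p * h p = b * b" for p
        using dim(2)[of p] h2[of _ _ p] by auto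
      have h0: "h p \<noteq> 0" for p using hh[of p] b by auto
      have hC: "h \<in> CM"
        unfolding h_def[abs_def] by (intro CM_add CM_const f)
      \<comment> \<open>The product rule for \<open>h\<^sup>2 = b\<^sup>2\<close>, with \<open>h\<close> nowhere zero.\<close>
      have dh: "X p h = 0" if X: "X \<in> XM" for X p
      proof -
        have "X p (\<lambda>q. h q * h q) = 0" by (simp add: hh tangent_const[OF XM_at[OF X]])
        then show ?thesis using tangent_mult[OF XM_at[OF X] hC hC, of p] h0[of p] by simp
      qed
      have df: "X p f = 0" if X: "X \<in> XM" for X p
      proof -
        have "f = (\<lambda>q. h q - (a + l))" by (simp add: h_def fun_eq_iff)
        then show ?thesis
          using tangent_diff[OF XM_at[OF X] hC CM_const, of p "a + l"]
          by (simp add: dh X tangent_const[OF XM_at[OF X]])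
      qed
      interpret torse_forming_constant A g D \<xi> \<eta> \<epsilon> f
        by unfold_locales (rule df)
      have f\<gamma>: "f p * (c + \<epsilon> * h p) = 0" for p
      proof -
        obtain X Y where XY: "X \<in> XM" "Y \<in> XM" "G p (X p) (Y p) \<noteq> 0" using dim(2) by blast
        show ?thesis
        proof (rule ricci_rigidity[where \<alpha>="\<lambda>p. a - h p" and \<gamma>="\<lambda>p. c + \<epsilon> * h p", OF _ _ _ _ Sh XY])
          show "(\<lambda>p. a - h p) \<in> CM" "(\<lambda>p. c + \<epsilon> * h p) \<in> CM"
            by (intro CM_diff CM_add CM_cmult CM_const hC)+
          fix X p assume X: "X \<in> XM"
          note t = XM_at[OF X, of p]
          show "X p (\<lambda>p. a - h p) = 0" "X p (\<lambda>p. c + \<epsilon> * h p) = 0"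
            by (simp_all add: tangent_diff[OF t] tangent_add[OF t] tangent_cmult[OF t] tangent_const[OF t]
                CM_const CM_cmult hC dh X)
        qed
      qed
      have ff: "a * \<epsilon> + c = - (f p)\<^sup>2 * (DIM('e) - 1)" for p
        using ricci_xi_xi[of p] S[OF xi xi, of p] by (simp add: g_phi_xi eta_xi g_xi xi)
      have f_zero: "f p = 0 \<Longrightarrow> f q = 0" for p q
        using ff[of p] ff[of q] dim(1) by simp
      \<comment> \<open>\<open>M\<close> may be disconnected, so \<open>h = b\<close> at one point and \<open>h = - b\<close> at another has to be excluded.\<close>
      have h_const: "h p = h q" for p q
      proof (rule ccontr)
        assume ne: "h p \<noteq> h q"
        have "(h p - h q) * (h p + h q) = 0" using hh[of p] hh[of q] by (simp add: algebra_simps)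
        then have hq: "h q = - h p" using ne by simp
        have "f p \<noteq> 0" "f q \<noteq> 0" using f_zero[of p q] f_zero[of q p] ne by (auto simp: h_def)
        then have "c + \<epsilon> * h p = 0" "c + \<epsilon> * h q = 0" using f\<gamma>[of p] f\<gamma>[of q] by auto
        then have "\<epsilon> * h p = 0" using hq by simp
        then show False using eps h0[of p] by auto
      qed
      show ?thesis unfolding eta_einstein_def
      proof (intro exI ballI allI)
        fix X Y p assume "X \<in> XM" "Y \<in> XM"
        then show "ricci A D X Y p = (a - h p0) * g p (X p) (Y p) + (c + \<epsilon> * h p0) * \<eta> p (X p) * \<eta> p (Y p)"
          using h_const[of p p0] by (simp add: Sh)
      qed
    qed
  qed
qed

end
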